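(* Let the cost $c:\mathcal S\times\mathcal U\to[0,\infty)$ be time-independent and assume: (1) $\mathcal U\subset\mathbb R^k$ is compact and convex with nonempty interior, and $u\mapsto\mathcal G^uf(t,x)$ is affine; (2) the reference measure $r_{t,x}\in\mathcal P(\mathcal U)$ admits a continuous density $\rho_{t,x}$ with respect to Lebesgue measure on $\mathcal U$, bounded above, bounded below away from zero, and equicontinuous in $u$, all uniformly in $(t,x)$; (3) $u\mapsto c(x,u)$ is $C^3$ on $\mathcal U$ with $mI\preceq\partial_u^2c(x,u)\preceq MI$ for constants $0<m\le M<\infty$ uniform in $x$; (4) $\sup_{x,u}q(x,\mathcal S;u)<\infty$, and there is $\kappa_V<\infty$ with $\sup_{u\in\mathcal U}\int_{\mathcal S}(1+V(y))\,q(x,dy;u)\le\kappa_V(1+V(x))$ for all $x$; (5) there exist $h:\mathcal S\to\mathbb R$ with $\|h\|_V<\infty$ and $g^*\in\mathbb R$ such that, with a (measurable) pointwise maximizer $u^{**}(x)\in\arg\max_{u\in\mathcal U}\{\mathcal G^uh(x)-c(x,u)\}$, one has $g^*+\mathcal G^{u^{**}}h(x)=c(x,u^{**}(x))$ for all $x$; (6) $x\mapsto\inf_{u\in\mathcal U}c(x,u)$ has relatively compact sublevel sets and $c$ is bounded on compact subsets of $\mathcal S\times\mathcal U$; $-h$ is bounded below with relatively compact sublevel sets; the process generated by $u^{**}$ is irreducible; and its unique invariant probability measure $\tilde\pi^*$ satisfies $\langle V,\tilde\pi^*\rangle<\infty$. Fix $T>0$ and put $f^*(t,x)=h(x)+(t-T)g^*$.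 For $\varepsilon>0$ define $$\mathcal F^{\mathrm{soft}}=\Big\{f:[0,T]\times\mathcal S\to\mathbb R:\ f(\cdot,x)\in C^1\ \forall x,\ \sup_t\|f(t,\cdot)\|_V+\sup_t\|\partial_tf(t,\cdot)\|_V<\infty,\ \partial_tf+\mathcal H^\varepsilon f\le0\Big\},$$ and suppose that, for each $\varepsilon>0$, $f^\varepsilon\in\mathcal F^{\mathrm{soft}}$ attains the supremum of $\langle f_T-f_0,\tilde\pi^*\rangle$ over $f\in\mathcal F^{\mathrm{soft}}$. Suppose further that there is $d_0>0$ (independent of $\varepsilon$) such that, for $f\in\{f^*,f^\varepsilon\}$ and every $(t,x)$, the maximizer over $\mathcal U$ of $u\mapsto\mathcal G^uf(t,x)-c(x,u)$ lies at distance at least $d_0$ from the boundary of $\mathcal U$. Then $$0\ \le\ \langle f^\varepsilon_T-f^\varepsilon_0,\tilde\pi^*\rangle-g^*T\ =\ \mathcal O\Big(T\varepsilon\log\tfrac1\varepsilon\Big)\qquad\text{as }\varepsilon\to0.$$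
   Context: Setting. $\mathcal S$ is a countable set with the discrete topology. The controlled jump generators are $\mathcal G^uf(x)=\int_{\mathcal S}[f(y)-f(x)]\,q(x,dy;u)$, $u\in\mathcal U$, with $q(x,\cdot\,;u)$ a (measurable) jump-rate kernel; for time-dependent $f$, $\mathcal G^uf(t,x)$ acts in $x$. For a map $\mu:\mathcal S\to\mathcal U$, $\mathcal G^\mu f(x)=\mathcal G^{\mu(x)}f(x)$, and the process generated by $\mu$ is the Markov jump process with generator $\mathcal G^\mu$. Standing stability assumption: $V:\mathcal S\to[0,\infty)$ has relatively compact (finite) sublevel sets, and there are $W:\mathcal S\to[1,\infty)$, a compact $C\subset\mathcal S$ and $b<\infty$ such that every admissible stationary control $\mu$ generates an irreducible (Harris) process with $\mathcal G^\mu V\le -W+b\mathbf 1_C$; and $0\le c(x,u)\le W(x)$. $\|\phi\|_V=\sup_x|\phi(x)|/(1+V(x))$; $\langle\phi,\nu\rangle=\int\phi\,d\nu$; $f_t=f(t,\cdot)$. For $\varepsilon>0$ and a reference control kernel $r_{t,x}\in\mathcal P(\mathcal U)$, $(t,x)\in[0,T]\times\mathcal S$, the soft Hamiltonian is $$\mathcal H^\varepsilon f(t,x)=\varepsilon\log\int_{\mathcal U}\exp\Big(\frac{\mathcal G^uf(t,x)-c(x,u)}{\varepsilon}\Big)\,r_{t,x}(du).$$ (Under hypotheses (1)–(6), existence and uniqueness of $\tilde\pi^*$ in (6) follow from the other hypotheses.) *)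

theory Defs
  imports "HOL-Probability.Probability" "HOL-Library.Landau_Symbols"
begin

text \<open>
  The state space is the type \<^typ>\<open>'s\<close> of class \<^class>\<open>countable\<close>, carrying the discrete
  topology and sigma-algebra; thus every set is measurable, and (relatively) compact means finite.
\<close>

section \<open>Controlled jump generators\<close>

definition jump_kernel :: "'u::euclidean_space set \<Rightarrow> ('s::countable \<Rightarrow> 'u \<Rightarrow> 's measure) \<Rightarrow> bool" where
  "jump_kernel U q \<longleftrightarrow>
     (\<forall>x. \<forall>u\<in>U. sets (q x u) = UNIV \<and> finite_measure (q x u)) \<and>
     (\<forall>x A. (\<lambda>u. emeasure (q x u) A) \<in> borel_measurable (restrict_space borel U))"

definition gen :: "('s \<Rightarrow> 'u \<Rightarrow> 's measure) \<Rightarrow> 'u \<Rightarrow> ('s \<Rightarrow> real) \<Rightarrow> 's \<Rightarrow> real" where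
  "gen q u \<phi> x = (\<integral>y. (\<phi> y - \<phi> x) \<partial>q x u)"

definition Vnorm :: "('s \<Rightarrow> real) \<Rightarrow> ('s \<Rightarrow> real) \<Rightarrow> ennreal" where
  "Vnorm V \<phi> = (SUP x. ennreal (\<bar>\<phi> x\<bar> / (1 + V x)))"

section \<open>The process generated by a stationary control\<close>

text \<open>
  A process is given by the family of its laws \<open>X x\<close>, one for each initial state \<open>x\<close>, on paths
  \<open>\<omega> :: real \<Rightarrow> 's\<close> of which only the restriction to the times \<open>t \<ge> 0\<close> is relevant.
\<close>

definition transition :: "('s \<Rightarrow> (real \<Rightarrow> 's) measure) \<Rightarrow> real \<Rightarrow> 's \<Rightarrow> 's set \<Rightarrow> real" where
  "transition X t x A = measure (X x) {\<omega> \<in> space (X x). \<omega> t \<in> A}"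

text \<open>
  The eventuality conditions are right-continuity and existence of left limits with respect to the
  discrete topology, so that there are only finitely many jumps in bounded time. The Markov property
  is stated on the finite-dimensional cylinders that generate the past up to time \<open>s\<close>.
  The last clause says that the generator, the derivative at \<open>t = 0\<close> of
  \<open>t \<mapsto> E\<^sub>x f(X\<^sub>t)\<close>, is the one of the control \<open>\<mu>\<close>.
\<close>

definition jump_process ::
  "('s::countable \<Rightarrow> 'u \<Rightarrow> 's measure) \<Rightarrow> ('s \<Rightarrow> 'u) \<Rightarrow> ('s \<Rightarrow> (real \<Rightarrow> 's) measure) \<Rightarrow> bool" where
  "jump_process q \<mu> X \<longleftrightarrow>
     (\<forall>x. prob_space (X x)) \<and>
     (\<forall>x. \<forall>t\<ge>0. (\<lambda>\<omega>. \<omega> t) \<in> measurable (X x) (count_space UNIV)) \<and>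
     (\<forall>x. \<forall>\<omega>\<in>space (X x). \<forall>t\<ge>0. \<forall>\<^sub>F s in at_right t. \<omega> s = \<omega> t) \<and>
     (\<forall>x. \<forall>\<omega>\<in>space (X x). \<forall>t>0. \<exists>y. \<forall>\<^sub>F s in at_left t. \<omega> s = y) \<and>
     (\<forall>x. AE \<omega> in X x. \<omega> 0 = x) \<and>
     (\<forall>x s t J \<eta> z y. 0 \<le> s \<longrightarrow> 0 \<le> t \<longrightarrow> finite J \<longrightarrow> J \<subseteq> {0..s} \<longrightarrow>
        measure (X x) {\<omega> \<in> space (X x). (\<forall>j\<in>J. \<omega> j = \<eta> j) \<and> \<omega> s = z \<and> \<omega> (s + t) = y}
        = measure (X x) {\<omega> \<in> space (X x). (\<forall>j\<in>J. \<omega> j = \<eta> j) \<and> \<omega> s = z} * transition X t z {y}) \<and>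
     (\<forall>f::'s \<Rightarrow> real. bounded (range f) \<longrightarrow>
        (\<forall>x. ((\<lambda>t. \<integral>\<omega>. f (\<omega> t) \<partial>X x) has_real_derivative gen q (\<mu> x) f x) (at 0 within {0..})))"

definition occupation_time :: "'s set \<Rightarrow> (real \<Rightarrow> 's) \<Rightarrow> ennreal" where
  "occupation_time A \<omega> = (\<integral>\<^sup>+t. indicator {t. 0 \<le> t \<and> \<omega> t \<in> A} t \<partial>lborel)"

text \<open>
  Irreducibility and Harris recurrence are those of general state space Markov processes, relative
  to some nontrivial sigma-finite measure. Irreducibility in the sense that all states communicate
  is the case of the counting measure.
\<close>

definition irreducible_process :: "('s::countable \<Rightarrow> (real \<Rightarrow> 's) measure) \<Rightarrow> bool" where
  "irreducible_process X \<longleftrightarrow>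
     (\<exists>\<psi>::'s measure. sigma_finite_measure \<psi> \<and> sets \<psi> = UNIV \<and> emeasure \<psi> UNIV > 0 \<and>
        (\<forall>A. emeasure \<psi> A > 0 \<longrightarrow> (\<forall>x. (\<integral>\<^sup>+\<omega>. occupation_time A \<omega> \<partial>X x) > 0)))"

definition harris_recurrent :: "('s::countable \<Rightarrow> (real \<Rightarrow> 's) measure) \<Rightarrow> bool" where
  "harris_recurrent X \<longleftrightarrow>
     (\<exists>\<psi>::'s measure. sigma_finite_measure \<psi> \<and> sets \<psi> = UNIV \<and> emeasure \<psi> UNIV > 0 \<and>
        (\<forall>A. emeasure \<psi> A > 0 \<longrightarrow> (\<forall>x. AE \<omega> in X x. occupation_time A \<omega> = \<infinity>)))"

definition invariant_prob :: "('s::countable \<Rightarrow> (real \<Rightarrow> 's) measure) \<Rightarrow> 's measure \<Rightarrow> bool" where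
  "invariant_prob X \<nu> \<longleftrightarrow> prob_space \<nu> \<and> sets \<nu> = UNIV \<and>
     (\<forall>t\<ge>0. \<forall>A. (\<integral>x. transition X t x A \<partial>\<nu>) = measure \<nu> A)"

section \<open>Regularity in the control\<close>

definition affine_fun_on :: "'u::real_vector set \<Rightarrow> ('u \<Rightarrow> real) \<Rightarrow> bool" where
  "affine_fun_on U F \<longleftrightarrow>
     (\<forall>u\<in>U. \<forall>v\<in>U. \<forall>a\<in>{0..1}. F ((1 - a) *\<^sub>R u + a *\<^sub>R v) = (1 - a) * F u + a * F v)"

text \<open>
  \<open>F\<close> is three times continuously differentiable on \<open>U\<close>, with second derivative \<open>F2\<close>. Derivatives
  are taken within \<open>U\<close>; they are unique for convex \<open>U\<close> with nonempty interior.
\<close>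

definition C3_on ::
  "'u::real_normed_vector set \<Rightarrow> ('u \<Rightarrow> real) \<Rightarrow> ('u \<Rightarrow> 'u \<Rightarrow>\<^sub>L 'u \<Rightarrow>\<^sub>L real) \<Rightarrow> bool" where
  "C3_on U F F2 \<longleftrightarrow>
     (\<exists>(F1 :: 'u \<Rightarrow> 'u \<Rightarrow>\<^sub>L real) (F3 :: 'u \<Rightarrow> 'u \<Rightarrow>\<^sub>L 'u \<Rightarrow>\<^sub>L 'u \<Rightarrow>\<^sub>L real).
        (\<forall>u\<in>U. (F has_derivative blinfun_apply (F1 u)) (at u within U)) \<and>
        (\<forall>u\<in>U. (F1 has_derivative blinfun_apply (F2 u)) (at u within U)) \<and>
        (\<forall>u\<in>U. (F2 has_derivative blinfun_apply (F3 u)) (at u within U)) \<and>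
        continuous_on U F3)"

section \<open>The soft Hamiltonian and the soft linear program\<close>

definition soft_hamiltonian ::
  "('s \<Rightarrow> 'u \<Rightarrow> 's measure) \<Rightarrow> ('s \<Rightarrow> 'u \<Rightarrow> real) \<Rightarrow> (real \<Rightarrow> 's \<Rightarrow> 'u measure) \<Rightarrow> real
    \<Rightarrow> (real \<Rightarrow> 's \<Rightarrow> real) \<Rightarrow> real \<Rightarrow> 's \<Rightarrow> real" where
  "soft_hamiltonian q c r \<epsilon> f t x =
     \<epsilon> * ln (\<integral>u. exp ((gen q u (f t) x - c x u) / \<epsilon>) \<partial>r t x)"

text \<open>Functions on \<open>[0,T] \<times> S\<close> are total functions of which only the values at \<open>t \<in> [0,T]\<close> matter.\<close>

definition F_soft ::
  "('s \<Rightarrow> 'u \<Rightarrow> 's measure) \<Rightarrow> ('s \<Rightarrow> 'u \<Rightarrow> real) \<Rightarrow> (real \<Rightarrow> 's \<Rightarrow> 'u measure) \<Rightarrow> ('s \<Rightarrow> real)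
    \<Rightarrow> real \<Rightarrow> real \<Rightarrow> (real \<Rightarrow> 's \<Rightarrow> real) set" where
  "F_soft q c r V T \<epsilon> = {f. \<exists>f'.
     (\<forall>x. \<forall>t\<in>{0..T}. ((\<lambda>s. f s x) has_real_derivative f' t x) (at t within {0..T})) \<and>
     (\<forall>x. continuous_on {0..T} (\<lambda>t. f' t x)) \<and>
     (SUP t\<in>{0..T}. Vnorm V (f t)) + (SUP t\<in>{0..T}. Vnorm V (f' t)) < \<infinity> \<and>
     (\<forall>t\<in>{0..T}. \<forall>x. f' t x + soft_hamiltonian q c r \<epsilon> f t x \<le> 0)}"

end

theory Submission
  imports Defs
begin

text \<open>
  The function \<open>f\<^sup>*(t, x) = h(x) + (t - T) g\<close> is feasible for the soft program: the soft Hamiltonian is a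
  log-average of \<open>u \<mapsto> G\<^sup>u h(x) - c(x, u)\<close> against a probability measure, hence at most its
  maximum, which is \<open>- g\<close> by the optimality equation for \<open>h\<close>. Its objective value is \<open>g T\<close>, so the
  optimum is at least \<open>g T\<close>.

  For the converse, Laplace's method bounds the soft Hamiltonian from below by the maximum minus an
  error \<open>\<delta>(\<epsilon>) = O(\<epsilon> log(1/\<epsilon>))\<close>, uniformly in \<open>t\<close> and \<open>x\<close>, for the soft optimizer
  \<open>f = f\<^sup>\<epsilon>\<close> (lemma \<open>soft_max_ge_max\<close>). The control \<open>u\<^sub>0\<close> that attains the
  maximum has distance at least \<open>d\<^sub>0\<close> from the boundary. The generator is affine in \<open>u\<close>, so it
  drops out of second differences, and the bound \<open>c'' \<le> M\<close> shows that moving from \<open>u\<^sub>0\<close> by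
  \<open>v\<close> loses at most \<open>M \<bar>v\<bar>\<^sup>2\<close>. On the ball of radius \<open>\<surd>\<epsilon>\<close> the loss is at most \<open>M \<epsilon>\<close>, and that ball
  has reference mass of order at least \<open>\<epsilon>\<^bsup>k/2\<^esup>\<close>.

  Feasibility of \<open>f\<close> therefore gives \<open>\<partial>\<^sub>t f \<le> c(x, \<mu>(x)) - G\<^sup>\<mu> f + \<delta>(\<epsilon>)\<close> for the control \<open>\<mu>\<close> that is
  maximal for \<open>h\<close>, and the optimality equation turns this into
  \<open>\<partial>\<^sub>t f \<le> g + G\<^sup>\<mu> h - G\<^sup>\<mu> f + \<delta>(\<epsilon>)\<close>. The invariant measure annihilates the range of the generator
  on functions of growth \<open>1 + V\<close> (lemma \<open>mean_gen_zero\<close>), so the mean of \<open>f\<^sub>t\<close> grows at a rate of at most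
  \<open>g + \<delta>(\<epsilon>)\<close> (lemma \<open>mean_increment_le\<close>).
\<close>

section \<open>Regularity of affine and of smooth functions\<close>

text \<open>
  In the interior this is the continuity of convex functions. Up to the boundary: if the increment from
  \<open>u\<close> to \<open>w\<close> is compared with a parallel increment of fixed length \<open>r\<close> at an interior point, affinity
  makes the two slopes equal, so \<open>F\<close> is Lipschitz with a constant read off from its bound near that
  point.
\<close>

lemma affine_fun_on_continuous_on:
  fixes F :: "'a::euclidean_space \<Rightarrow> real"
  assumes U: "convex U" "interior U \<noteq> {}" and F: "affine_fun_on U F"
  shows "continuous_on U F"
proof -
  obtain a where "a \<in> interior U" using U(2) by blast
  then obtain e where e: "0 < e" "ball a e \<subseteq> U"
    by (meson interior_subset open_contains_ball open_interior subset_trans)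
  have "convex_on (ball a e) F"
  proof (rule convex_onI)
    fix t :: real and x y
    assume "0 < t" "t < 1" "x \<in> ball a e" "y \<in> ball a e"
    then show "F ((1 - t) *\<^sub>R x + t *\<^sub>R y) \<le> (1 - t) * F x + t * F y"
      using F e(2) unfolding affine_fun_on_def by (smt (verit) atLeastAtMost_iff subsetD)
  qed simp
  then have "continuous_on (ball a e) F" by (rule convex_on_continuous[OF open_ball])
  define r where "r = e / 2"
  have r: "0 < r" "cball a r \<subseteq> ball a e" using e(1) by (auto simp: r_def)
  have "continuous_on (cball a r) F"
    using \<open>continuous_on (ball a e) F\<close> r(2) continuous_on_subset by blast
  then have "bounded (F ` cball a r)" by (intro compact_imp_bounded compact_continuous_image compact_cball)
  then obtain B where "\<forall>y\<in>F ` cball a r. norm y \<le> B" unfolding bounded_iff by blast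
  then have B: "\<And>x. x \<in> cball a r \<Longrightarrow> \<bar>F x\<bar> \<le> B" by simp
  have lip: "\<bar>F u - F w\<bar> \<le> 2 * B / r * dist u w" if uw: "u \<in> U" "w \<in> U" for u w
  proof (cases "u = w")
    case False
    define d where "d = norm (w - u)"
    have d: "0 < d" using False by (simp add: d_def)
    define v where "v = (r / d) *\<^sub>R (w - u)"
    have nv: "norm v = r" using d r(1) by (simp add: v_def d_def)
    then have av: "a + v \<in> cball a r" "a \<in> cball a r" using r(1) by (auto simp: dist_norm)
    then have avU: "a + v \<in> U" "a \<in> U" using r(2) e(2) by blast+
    \<comment> \<open>The weight for which the point of the segment from \<open>u\<close> to \<open>a + v\<close> is also the point of the
      segment from \<open>w\<close> to \<open>a\<close>.\<close>
    define l where "l = d / (r + d)"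
    have l: "l \<in> {0..1}" "(1 - l) = r / (r + d)" using d r(1) by (auto simp: l_def field_simps)
    have "l *\<^sub>R v = (1 - l) *\<^sub>R (w - u)" using d r(1) unfolding l(2) by (simp add: l_def v_def)
    then have "(1 - l) *\<^sub>R u + l *\<^sub>R (a + v) = (1 - l) *\<^sub>R w + l *\<^sub>R a"
      by (simp add: algebra_simps)
    then have "(1 - l) * F u + l * F (a + v) = (1 - l) * F w + l * F a"
      using F uw avU l(1) unfolding affine_fun_on_def by metis
    then have "(1 - l) * (F u - F w) = l * (F a - F (a + v))" by (simp add: algebra_simps)
    then have "r * (F u - F w) = d * (F a - F (a + v))"
      using d r(1) unfolding l(2) by (simp add: l_def field_simps)
    then have "r * \<bar>F u - F w\<bar> = d * \<bar>F a - F (a + v)\<bar>"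
      using d r(1) by (metis abs_mult abs_of_pos)
    also have "\<dots> \<le> d * (2 * B)"
      using B[OF av(1)] B[OF av(2)] d by (intro mult_left_mono) auto
    finally show ?thesis
      using r(1) by (simp add: d_def dist_norm norm_minus_commute field_simps)
  qed simp
  have "0 \<le> B" using B[of a] r(1) by auto
  then have "(2 * B / r)-lipschitz_on U F"
    using lip r(1) by (intro lipschitz_onI) (auto simp: dist_real_def)
  then show ?thesis by (rule lipschitz_on_continuous_on)
qed

lemma C3_on_imp_continuous_on:
  fixes F :: "'a::real_normed_vector \<Rightarrow> real"
  assumes "C3_on U F F2"
  shows "continuous_on U F"
proof -
  obtain F1 :: "'a \<Rightarrow> 'a \<Rightarrow>\<^sub>L real"
    where "\<forall>u\<in>U. (F has_derivative blinfun_apply (F1 u)) (at u within U)"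
    using assms unfolding C3_on_def by (elim exE conjE)
  then show ?thesis
    by (intro has_derivative_continuous_on[where f' = "\<lambda>u. blinfun_apply (F1 u)"]) simp
qed

text \<open>
  The function \<open>s \<mapsto> M \<bar>v\<bar>\<^sup>2 s\<^sup>2 / 2 - F (a + s v)\<close> is convex on an interval containing \<open>[-1, 1]\<close>;
  midpoint convexity at \<open>0\<close> is the claim.
\<close>

lemma second_difference_le:
  fixes F :: "'a::real_normed_vector \<Rightarrow> real"
  assumes F: "C3_on U F F2" and ball: "ball a R \<subseteq> U"
    and hess: "\<And>u v. u \<in> U \<Longrightarrow> F2 u v v \<le> M * (norm v)\<^sup>2" and v: "norm v < R"
  shows "F (a + v) + F (a - v) - 2 * F a \<le> M * (norm v)\<^sup>2"
proof -
  obtain F1 F3 where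
    F1: "\<And>u. u \<in> U \<Longrightarrow> (F has_derivative blinfun_apply (F1 u)) (at u within U)" and
    F2: "\<And>u. u \<in> U \<Longrightarrow> (F1 has_derivative blinfun_apply (F2 u)) (at u within U)"
    using F unfolding C3_on_def by blast
  have R: "0 < R" using v by (smt (verit) norm_ge_zero)
  define I where "I = {s::real. norm (s *\<^sub>R v) < R}"
  have at_U: "at (a + s *\<^sub>R v) within U = at (a + s *\<^sub>R v)" and in_U: "a + s *\<^sub>R v \<in> U" if "s \<in> I" for s
  proof -
    have "a + s *\<^sub>R v \<in> ball a R" using that by (auto simp: I_def dist_norm)
    then show "a + s *\<^sub>R v \<in> U" using ball by blast
    show "at (a + s *\<^sub>R v) within U = at (a + s *\<^sub>R v)"
      using \<open>a + s *\<^sub>R v \<in> ball a R\<close> ball by (intro at_within_interior) (auto simp: interior_def)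
  qed
  define G where "G s = M * (norm v)\<^sup>2 * s\<^sup>2 / 2 - F (a + s *\<^sub>R v)" for s
  have cI: "convex I"
  proof -
    have "I = (\<lambda>s. s *\<^sub>R v) -` ball 0 R" by (auto simp: I_def)
    then show ?thesis
      by (simp add: convex_linear_vimage linear_scaleR_left)
  qed
  have "convex_on I G"
  proof (rule f''_ge0_imp_convex)
    show "convex I" by (rule cI)
  next
    fix s assume s: "s \<in> I"
    have "((\<lambda>s. F (a + s *\<^sub>R v)) has_derivative (\<lambda>t. F1 (a + s *\<^sub>R v) (t *\<^sub>R v))) (at s)"
      by (rule has_derivative_compose[where f = "\<lambda>s. a + s *\<^sub>R v" and x = s and g = F, OF _ F1[OF in_U[OF s], unfolded at_U[OF s]]])
         (auto intro!: derivative_eq_intros)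
    then have "((\<lambda>s. F (a + s *\<^sub>R v)) has_real_derivative F1 (a + s *\<^sub>R v) v) (at s)"
      by (simp add: has_field_derivative_def blinfun.scaleR_right mult_commute_abs)
    then show "(G has_real_derivative M * (norm v)\<^sup>2 * s - F1 (a + s *\<^sub>R v) v) (at s)"
      unfolding G_def by (auto intro!: derivative_eq_intros)
    have "((\<lambda>s. F1 (a + s *\<^sub>R v)) has_derivative (\<lambda>t. F2 (a + s *\<^sub>R v) (t *\<^sub>R v))) (at s)"
      by (rule has_derivative_compose[where f = "\<lambda>s. a + s *\<^sub>R v" and x = s and g = F1, OF _ F2[OF in_U[OF s], unfolded at_U[OF s]]])
         (auto intro!: derivative_eq_intros)
    then have "((\<lambda>s. F1 (a + s *\<^sub>R v) v) has_derivative (\<lambda>t. F2 (a + s *\<^sub>R v) (t *\<^sub>R v) v)) (at s)"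
      by (rule bounded_linear.has_derivative[OF blinfun.bounded_linear_left])
    then have "((\<lambda>s. F1 (a + s *\<^sub>R v) v) has_real_derivative F2 (a + s *\<^sub>R v) v v) (at s)"
      by (simp add: has_field_derivative_def blinfun.scaleR_right blinfun.scaleR_left mult_commute_abs)
    then show "((\<lambda>s. M * (norm v)\<^sup>2 * s - F1 (a + s *\<^sub>R v) v) has_real_derivative
        M * (norm v)\<^sup>2 - F2 (a + s *\<^sub>R v) v v) (at s)"
      by (auto intro!: derivative_eq_intros)
    show "0 \<le> M * (norm v)\<^sup>2 - F2 (a + s *\<^sub>R v) v v" using hess[OF in_U[OF s], of v] by simp
  qed
  \<comment> \<open>\<open>0\<close> as the midpoint of \<open>- 1\<close> and \<open>1\<close>\<close>
  then have "G ((1 - 1/2) *\<^sub>R (- 1) + (1/2) *\<^sub>R 1) \<le> (1 - 1/2) * G (- 1) + 1/2 * G 1"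
    by (rule convex_onD) (use v in \<open>auto simp: I_def\<close>)
  then show ?thesis by (simp add: G_def field_simps)
qed

section \<open>Laplace's method\<close>

lemma ball_subset_of_infdist_frontier:
  fixes U :: "'a::real_normed_vector set"
  assumes "u \<in> U" "d \<le> infdist u (frontier U)"
  shows "ball u d \<subseteq> U"
proof (cases "0 < d")
  case True
  show ?thesis
  proof (rule ccontr)
    assume "\<not> ball u d \<subseteq> U"
    moreover have "u \<in> ball u d \<inter> U" using True assms(1) by simp
    ultimately have "ball u d \<inter> frontier U \<noteq> {}"
      using connected_Int_frontier[OF convex_connected[OF convex_ball], of u d U] by blast
    then obtain z where "z \<in> frontier U" "dist u z < d" by auto
    then show False using infdist_le[of z "frontier U" u] assms(2) by simp
  qed
next
  case False
  then show ?thesis by (simp add: ball_empty)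
qed

lemma integrable_exp_continuous:
  fixes N :: "'a::euclidean_space measure" and F :: "'a \<Rightarrow> real"
  assumes N: "prob_space N" "sets N = sets (restrict_space borel U)"
    and U: "compact U" and F: "continuous_on U F"
  shows "integrable N (\<lambda>u. exp (F u / \<epsilon>))"
proof -
  interpret prob_space N by fact
  have sp: "space N = U" using sets_eq_imp_space_eq[OF N(2)] by (simp add: space_restrict_space)
  have c: "continuous_on U (\<lambda>u. exp (F u / \<epsilon>))"
    unfolding divide_inverse by (intro continuous_on_exp continuous_on_mult continuous_on_const F)
  then have "bounded ((\<lambda>u. exp (F u / \<epsilon>)) ` U)"
    using U by (intro compact_imp_bounded compact_continuous_image)
  then obtain B where B: "\<And>u. u \<in> U \<Longrightarrow> norm (exp (F u / \<epsilon>)) \<le> B" by (auto simp: bounded_iff)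
  show ?thesis
  proof (rule integrable_const_bound[of _ B])
    show "AE u in N. norm (exp (F u / \<epsilon>)) \<le> B" using B by (intro AE_I2) (simp add: sp)
    show "(\<lambda>u. exp (F u / \<epsilon>)) \<in> borel_measurable N"
      using borel_measurable_continuous_on_restrict[OF c] N(2) measurable_cong_sets by blast
  qed
qed

text \<open>
  The exponential integral is at least \<open>exp (a / \<epsilon>)\<close> times the mass of any set on which
  \<open>a \<le> F\<close>. Its positivity is recorded because \<open>ln 0 = 0\<close> would spoil the upper bound below.
\<close>

lemma soft_max_ge:
  fixes N :: "'a::euclidean_space measure" and F :: "'a \<Rightarrow> real"
  assumes N: "prob_space N" "sets N = sets (restrict_space borel U)"
    and U: "compact U" and F: "continuous_on U F" and \<epsilon>: "0 < \<epsilon>"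
    and A: "A \<in> sets N" "\<And>u. u \<in> A \<Longrightarrow> a \<le> F u" and p: "0 < p" "p \<le> measure N A"
  shows "a + \<epsilon> * ln p \<le> \<epsilon> * ln (\<integral>u. exp (F u / \<epsilon>) \<partial>N)" and "0 < (\<integral>u. exp (F u / \<epsilon>) \<partial>N)"
proof -
  interpret prob_space N by fact
  have "exp (a / \<epsilon>) * p \<le> exp (a / \<epsilon>) * measure N A" using p by simp
  also have "\<dots> = (\<integral>u. exp (a / \<epsilon>) * indicator A u \<partial>N)" using A(1) by simp
  also have "\<dots> \<le> (\<integral>u. exp (F u / \<epsilon>) \<partial>N)"
  proof (rule integral_mono)
    show "integrable N (\<lambda>u. exp (a / \<epsilon>) * indicator A u)"
      using A(1) by (intro integrable_mult_right) (simp add: emeasure_eq_measure)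
    show "integrable N (\<lambda>u. exp (F u / \<epsilon>))" by (rule integrable_exp_continuous[OF N U F])
    show "exp (a / \<epsilon>) * indicator A u \<le> exp (F u / \<epsilon>)" for u
      using A(2)[of u] \<epsilon> by (auto simp: indicator_def divide_right_mono)
  qed
  finally have le: "exp (a / \<epsilon>) * p \<le> (\<integral>u. exp (F u / \<epsilon>) \<partial>N)" .
  then show pos: "0 < (\<integral>u. exp (F u / \<epsilon>) \<partial>N)" by (smt (verit) p(1) exp_gt_zero mult_pos_pos)
  have "a / \<epsilon> + ln p = ln (exp (a / \<epsilon>) * p)" using p(1) by (simp add: ln_mult)
  also have "\<dots> \<le> ln (\<integral>u. exp (F u / \<epsilon>) \<partial>N)" using le pos p(1) by (subst ln_le_cancel_iff) auto
  finally have "\<epsilon> * (a / \<epsilon> + ln p) \<le> \<epsilon> * ln (\<integral>u. exp (F u / \<epsilon>) \<partial>N)" using \<epsilon> by simp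
  then show "a + \<epsilon> * ln p \<le> \<epsilon> * ln (\<integral>u. exp (F u / \<epsilon>) \<partial>N)" using \<epsilon> by (simp add: distrib_left)
qed

lemma soft_max_le:
  fixes N :: "'a::euclidean_space measure" and F :: "'a \<Rightarrow> real"
  assumes N: "prob_space N" "sets N = sets (restrict_space borel U)"
    and U: "compact U" and F: "continuous_on U F" and \<epsilon>: "0 < \<epsilon>"
    and B: "\<And>u. u \<in> U \<Longrightarrow> F u \<le> B"
  shows "\<epsilon> * ln (\<integral>u. exp (F u / \<epsilon>) \<partial>N) \<le> B"
proof -
  interpret prob_space N by fact
  have sp: "space N = U" using sets_eq_imp_space_eq[OF N(2)] by (simp add: space_restrict_space)
  have "bounded (F ` U)" using U F by (intro compact_imp_bounded compact_continuous_image)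
  then obtain a where "\<And>u. u \<in> U \<Longrightarrow> \<bar>F u\<bar> \<le> a" by (auto simp: bounded_iff)
  then have a: "\<And>u. u \<in> U \<Longrightarrow> - a \<le> F u" by fastforce
  have pos: "0 < (\<integral>u. exp (F u / \<epsilon>) \<partial>N)"
    by (rule soft_max_ge(2)[OF N U F \<epsilon>, of U "-a" 1])
       (use a prob_space sets.top[of N] sp in auto)
  have "(\<integral>u. exp (F u / \<epsilon>) \<partial>N) \<le> exp (B / \<epsilon>)"
    using \<epsilon> by (intro integral_le_const integrable_exp_continuous[OF N U F] AE_I2)
               (auto simp: sp B divide_right_mono)
  then have "ln (\<integral>u. exp (F u / \<epsilon>) \<partial>N) \<le> B / \<epsilon>" using pos by (metis ln_exp ln_le_cancel_iff exp_gt_zero)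
  then show ?thesis using \<epsilon> by (simp add: field_simps)
qed

text \<open>
  On the ball of radius \<open>\<surd>\<epsilon>\<close> the loss \<open>M \<bar>u - u\<^sub>0\<bar>\<^sup>2\<close> is at most \<open>M \<epsilon>\<close>, which costs a
  constant factor \<open>exp (- M)\<close> after division by \<open>\<epsilon>\<close>; the mass of the ball, of order \<open>\<epsilon>\<^bsup>k/2\<^esup>\<close> in dimension
  \<open>k\<close>, is what produces the logarithm.
\<close>

lemma soft_max_ge_near_interior_max:
  fixes N :: "'a::euclidean_space measure" and F :: "'a \<Rightarrow> real"
  assumes N: "prob_space N" and dens: "N = density (restrict_space lborel U) (\<lambda>u. ennreal (\<rho> u))"
    and \<rho>: "continuous_on U \<rho>" "0 < \<rho>lo" "\<And>u. u \<in> U \<Longrightarrow> \<rho>lo \<le> \<rho> u"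
    and U: "compact U" and F: "continuous_on U F" and \<epsilon>: "0 < \<epsilon>"
    and ball: "ball u\<^sub>0 (sqrt \<epsilon>) \<subseteq> U"
    and quad: "\<And>u. u \<in> ball u\<^sub>0 (sqrt \<epsilon>) \<Longrightarrow> F u\<^sub>0 - M * (dist u u\<^sub>0)\<^sup>2 \<le> F u" and M: "0 \<le> M"
  shows "F u\<^sub>0 - \<epsilon> * (M - ln (\<rho>lo * unit_ball_vol (real DIM('a))) + real DIM('a) / 2 * ln (1 / \<epsilon>))
           \<le> \<epsilon> * ln (\<integral>u. exp (F u / \<epsilon>) \<partial>N)"
proof -
  interpret prob_space N by fact
  let ?B = "ball u\<^sub>0 (sqrt \<epsilon>)" and ?w = "unit_ball_vol (real DIM('a))"
  have Ub: "U \<in> sets borel" using U by (simp add: borel_compact)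
  have sN: "sets N = sets (restrict_space borel U)"
    by (simp add: dens) (simp add: sets_restrict_space)
  have BN: "?B \<in> sets N" using ball Ub unfolding sN by (auto simp: sets_restrict_space_iff)
  have w: "0 < ?w" by simp
  define p where "p = \<rho>lo * (?w * sqrt \<epsilon> ^ DIM('a))"
  have p: "0 < p" unfolding p_def using \<rho>(2) \<epsilon> w by simp
  have "ennreal p = ennreal \<rho>lo * emeasure lborel ?B"
    using \<rho>(2) \<epsilon> w by (simp add: p_def emeasure_ball ennreal_mult)
  also have "\<dots> = (\<integral>\<^sup>+u. ennreal \<rho>lo * indicator ?B u \<partial>lborel)"
    by (simp add: nn_integral_cmult_indicator)
  also have "\<dots> \<le> (\<integral>\<^sup>+u. (ennreal (\<rho> u) * indicator ?B u) * indicator U u \<partial>lborel)"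
    using ball \<rho>(3) by (intro nn_integral_mono) (auto simp: indicator_def intro!: ennreal_leI)
  also have "\<dots> = (\<integral>\<^sup>+u. ennreal (\<rho> u) * indicator ?B u \<partial>restrict_space lborel U)"
    using Ub by (subst nn_integral_restrict_space) auto
  also have "\<dots> = emeasure N ?B"
  proof -
    have "\<rho> \<in> borel_measurable (restrict_space lborel U)"
      using borel_measurable_continuous_on_restrict[OF \<rho>(1)]
      by (subst measurable_cong_sets[OF _ refl, of _ "restrict_space borel U"])
         (auto simp: sets_restrict_space)
    then show ?thesis
      unfolding dens using BN by (subst emeasure_density) (auto simp: dens)
  qed
  finally have "p \<le> measure N ?B" by (simp add: emeasure_eq_measure)
  moreover have "F u\<^sub>0 - M * \<epsilon> \<le> F u" if "u \<in> ?B" for u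
  proof -
    have "(dist u u\<^sub>0)\<^sup>2 \<le> (sqrt \<epsilon>)\<^sup>2" using that by (intro power_mono) (auto simp: dist_commute)
    then have "M * (dist u u\<^sub>0)\<^sup>2 \<le> M * \<epsilon>" using M \<epsilon> by (simp add: mult_left_mono)
    then show ?thesis using quad[OF that] by simp
  qed
  ultimately have le: "F u\<^sub>0 - M * \<epsilon> + \<epsilon> * ln p \<le> \<epsilon> * ln (\<integral>u. exp (F u / \<epsilon>) \<partial>N)"
    by (intro soft_max_ge(1)[OF N sN U F \<epsilon> BN _ p])
  have "ln p = ln (\<rho>lo * ?w) - real DIM('a) / 2 * ln (1 / \<epsilon>)"
  proof -
    have "ln p = ln ((\<rho>lo * ?w) * sqrt \<epsilon> ^ DIM('a))" by (simp add: p_def mult.assoc)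
    also have "\<dots> = ln (\<rho>lo * ?w) + real DIM('a) * ln (sqrt \<epsilon>)"
      using \<rho>(2) w \<epsilon> by (subst ln_mult) (auto simp: ln_realpow simp del: unit_ball_vol_pos)
    finally show ?thesis using \<epsilon> by (simp add: ln_sqrt ln_div)
  qed
  with le show ?thesis by (simp add: algebra_simps)
qed

text \<open>
  Averaging the two points \<open>u\<^sub>0 + v\<close> and \<open>u\<^sub>0 - v\<close> around the maximizer cancels the affine part, and
  the value at \<open>u\<^sub>0 - v\<close> is at most the maximum, so the second difference bound for \<open>c\<close> controls the
  loss at \<open>u\<^sub>0 + v\<close> alone. The error depends on \<open>G\<close>, \<open>c\<close> and \<open>N\<close> only through \<open>M\<close> and \<open>\<rho>lo\<close>.
\<close>

lemma soft_max_ge_max: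
  fixes N :: "'a::euclidean_space measure" and G c :: "'a \<Rightarrow> real"
  assumes N: "prob_space N" "N = density (restrict_space lborel U) (\<lambda>u. ennreal (\<rho> u))"
    and \<rho>: "continuous_on U \<rho>" "0 < \<rho>lo" "\<And>u. u \<in> U \<Longrightarrow> \<rho>lo \<le> \<rho> u"
    and U: "compact U" "convex U" "interior U \<noteq> {}"
    and G: "affine_fun_on U G" and c: "C3_on U c c2"
    and hess: "\<And>u v. u \<in> U \<Longrightarrow> c2 u v v \<le> M * (v \<bullet> v)" and M: "0 \<le> M"
    and d: "\<And>u. is_arg_max (\<lambda>u. G u - c u) (\<lambda>u. u \<in> U) u \<Longrightarrow> d \<le> infdist u (frontier U)"
    and \<epsilon>: "0 < \<epsilon>" "sqrt \<epsilon> \<le> d" and w: "w \<in> U"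
  shows "G w - c w - \<epsilon> * (M - ln (\<rho>lo * unit_ball_vol (real DIM('a))) + real DIM('a) / 2 * ln (1 / \<epsilon>))
           \<le> \<epsilon> * ln (\<integral>u. exp ((G u - c u) / \<epsilon>) \<partial>N)"
proof -
  have cont: "continuous_on U (\<lambda>u. G u - c u)"
    by (intro continuous_on_diff affine_fun_on_continuous_on[OF U(2,3) G] C3_on_imp_continuous_on[OF c])
  have "U \<noteq> {}" using w by blast
  from continuous_attains_sup[OF U(1) this cont] obtain u\<^sub>0 where u\<^sub>0: "u\<^sub>0 \<in> U" "\<And>u. u \<in> U \<Longrightarrow> G u - c u \<le> G u\<^sub>0 - c u\<^sub>0"
    by blast
  then have "is_arg_max (\<lambda>u. G u - c u) (\<lambda>u. u \<in> U) u\<^sub>0" by (auto simp: is_arg_max_def not_less)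
  then have ball: "ball u\<^sub>0 d \<subseteq> U" by (intro ball_subset_of_infdist_frontier u\<^sub>0 d)
  have quad: "G u\<^sub>0 - c u\<^sub>0 - M * (dist u u\<^sub>0)\<^sup>2 \<le> G u - c u" if "u \<in> ball u\<^sub>0 (sqrt \<epsilon>)" for u
  proof -
    define v where "v = u - u\<^sub>0"
    have v: "norm v < d" using that \<epsilon>(2) by (auto simp: v_def dist_norm norm_minus_commute)
    then have vU: "u\<^sub>0 + v \<in> U" "u\<^sub>0 - v \<in> U" using ball by (auto simp: subset_iff dist_norm)
    have half: "1 / 2 \<in> {0..1 :: real}" by simp
    have "(1 - 1/2 :: real) *\<^sub>R (u\<^sub>0 + v) + (1/2 :: real) *\<^sub>R (u\<^sub>0 - v) = (1/2 :: real) *\<^sub>R (u\<^sub>0 + u\<^sub>0)"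
      by (simp add: scaleR_add_right scaleR_diff_right)
    also have "\<dots> = u\<^sub>0" by (rule scaleR_half_double)
    finally have "G u\<^sub>0 = (1 - 1/2) * G (u\<^sub>0 + v) + 1/2 * G (u\<^sub>0 - v)"
      using G[unfolded affine_fun_on_def, rule_format, OF vU half] by simp
    then have "G (u\<^sub>0 + v) + G (u\<^sub>0 - v) = 2 * G u\<^sub>0" by simp
    moreover have "c (u\<^sub>0 + v) + c (u\<^sub>0 - v) - 2 * c u\<^sub>0 \<le> M * (norm v)\<^sup>2"
      using hess by (intro second_difference_le[OF c ball _ v]) (simp add: power2_norm_eq_inner)
    moreover have "G (u\<^sub>0 - v) - c (u\<^sub>0 - v) \<le> G u\<^sub>0 - c u\<^sub>0" by (rule u\<^sub>0(2)[OF vU(2)])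
    ultimately have "G u\<^sub>0 - c u\<^sub>0 - M * (norm v)\<^sup>2 \<le> G (u\<^sub>0 + v) - c (u\<^sub>0 + v)" by linarith
    then show ?thesis by (simp add: v_def dist_norm)
  qed
  have sball: "ball u\<^sub>0 (sqrt \<epsilon>) \<subseteq> U" using ball subset_ball[OF \<epsilon>(2), of u\<^sub>0] by blast
  show ?thesis
    using soft_max_ge_near_interior_max[OF N \<rho> U(1) cont \<epsilon>(1) sball quad M] u\<^sub>0(2)[OF w] by linarith
qed

section \<open>The generator has mean zero under the invariant measure\<close>

text \<open>
  The sequence of times \<open>t / (n + 1)\<close> fits both uses below: fixed multiples of these times reach
  \<open>t\<close>, and dominated convergence needs a sequence.
\<close>

lemma transition_difference_quotient:
  fixes q :: "'s::countable \<Rightarrow> 'u \<Rightarrow> 's measure"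
  assumes X: "jump_process q \<mu> X" and t: "0 < t"
  shows "(\<lambda>n. (transition X (t / real (Suc n)) x A - indicator A x) / (t / real (Suc n)))
           \<longlonglongrightarrow> gen q (\<mu> x) (indicator A) x"
proof -
  interpret prob_space "X x" using X by (simp add: jump_process_def)
  have ind: "(\<integral>\<omega>. indicator A (\<omega> s) \<partial>X x) = transition X s x A" if "0 \<le> s" for s
  proof -
    have "(\<lambda>\<omega>. \<omega> s) \<in> measurable (X x) (count_space UNIV)" using X that by (simp add: jump_process_def)
    then have "{\<omega> \<in> space (X x). \<omega> s \<in> A} \<in> sets (X x)" by measurable
    moreover have "(\<integral>\<omega>. indicator A (\<omega> s) \<partial>X x) = (\<integral>\<omega>. indicat_real {\<omega> \<in> space (X x). \<omega> s \<in> A} \<omega> \<partial>X x)"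
      by (intro Bochner_Integration.integral_cong) (auto simp: indicator_def)
    ultimately show ?thesis by (simp add: transition_def)
  qed
  have "transition X 0 x A = indicator A x"
  proof -
    have ae: "AE \<omega> in X x. \<omega> 0 = x" using X by (simp add: jump_process_def)
    have "(\<lambda>\<omega>. \<omega> 0) \<in> measurable (X x) (count_space UNIV)" using X by (simp add: jump_process_def)
    then have [measurable]: "(\<lambda>\<omega>. indicator A (\<omega> 0) :: real) \<in> borel_measurable (X x)"
      by (rule measurable_compose) simp
    have "(\<integral>\<omega>. indicator A (\<omega> 0) \<partial>X x) = (\<integral>\<omega>. indicat_real A x \<partial>X x)"
      using ae by (intro integral_cong_AE) auto
    then show ?thesis using ind[of 0] by (simp add: prob_space)
  qed
  have "bounded (range (indicator A :: 's \<Rightarrow> real))"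
    by (auto simp: bounded_iff indicator_def intro!: exI[of _ 1])
  then have "((\<lambda>s. \<integral>\<omega>. indicator A (\<omega> s) \<partial>X x) has_real_derivative gen q (\<mu> x) (indicator A) x) (at 0 within {0..})"
    using X unfolding jump_process_def by blast
  then have "((\<lambda>s. ((\<integral>\<omega>. indicator A (\<omega> s) \<partial>X x) - (\<integral>\<omega>. indicator A (\<omega> 0) \<partial>X x)) / (s - 0))
       \<longlongrightarrow> gen q (\<mu> x) (indicator A) x) (at 0 within {0..})"
    unfolding has_field_derivative_iff .
  moreover have "filterlim (\<lambda>n. t / real (Suc n)) (at 0 within {0..}) sequentially"
  proof (subst filterlim_at, intro conjI)
    show "\<forall>\<^sub>F n in sequentially. t / real (Suc n) \<in> {0..} \<and> t / real (Suc n) \<noteq> 0" using t by simp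
    show "(\<lambda>n. t / real (Suc n)) \<longlonglongrightarrow> 0" by (rule lim_const_over_n[THEN LIMSEQ_Suc])
  qed
  ultimately have "(\<lambda>n. ((\<integral>\<omega>. indicator A (\<omega> (t / real (Suc n))) \<partial>X x) - (\<integral>\<omega>. indicator A (\<omega> 0) \<partial>X x))
      / (t / real (Suc n) - 0)) \<longlonglongrightarrow> gen q (\<mu> x) (indicator A) x"
    by (rule filterlim_compose)
  then show ?thesis using t ind \<open>transition X 0 x A = indicator A x\<close> by simp
qed

text \<open>
  By the Markov property the probability \<open>P\<^sub>x(X\<^sub>t \<noteq> x)\<close> is subadditive in \<open>t\<close>, and a subadditive
  function vanishing at \<open>0\<close> is bounded by its derivative at \<open>0\<close> times \<open>t\<close>. That derivative is the rate
  of leaving \<open>x\<close>. The resulting bound is uniform in \<open>x\<close>, unlike the pointwise derivative that defines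
  the process.
\<close>

lemma exit_probability_le:
  fixes q :: "'s::countable \<Rightarrow> 'u \<Rightarrow> 's measure"
  assumes X: "jump_process q \<mu> X" and t: "0 < t"
    and fin: "finite_measure (q x (\<mu> x))" and sets: "sets (q x (\<mu> x)) = UNIV"
    and \<Lambda>: "measure (q x (\<mu> x)) UNIV \<le> \<Lambda>"
  shows "1 - transition X t x {x} \<le> \<Lambda> * t"
proof -
  interpret prob_space "X x" using X by (simp add: jump_process_def)
  interpret Q: finite_measure "q x (\<mu> x)" by fact
  define h where "h s = 1 - transition X s x {x}" for s
  have ev: "{\<omega> \<in> space (X x). \<omega> s = x} \<in> sets (X x)" if "0 \<le> s" for s
  proof -
    have [measurable]: "(\<lambda>\<omega>. \<omega> s) \<in> measurable (X x) (count_space UNIV)"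
      using X that by (simp add: jump_process_def)
    show ?thesis by measurable
  qed
  \<comment> \<open>Chapman-Kolmogorov restricted to paths that sit at \<open>x\<close> at the intermediate time; \<open>J = {}\<close> imposes no
    condition on the earlier past.\<close>
  have sub: "h (s + s') \<le> h s + h s'" if s: "0 \<le> s" "0 \<le> s'" for s s'
  proof -
    have "measure (X x) {\<omega> \<in> space (X x). (\<forall>j\<in>{}. \<omega> j = undefined j) \<and> \<omega> s = x \<and> \<omega> (s + s') = x}
        = measure (X x) {\<omega> \<in> space (X x). (\<forall>j\<in>{}. \<omega> j = undefined j) \<and> \<omega> s = x} * transition X s' x {x}"
      using X s unfolding jump_process_def by blast
    then have "transition X s x {x} * transition X s' x {x}
        = measure (X x) {\<omega> \<in> space (X x). \<omega> s = x \<and> \<omega> (s + s') = x}"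
      by (simp add: transition_def)
    also have "\<dots> \<le> transition X (s + s') x {x}"
      unfolding transition_def using ev[of "s + s'"] s by (intro finite_measure_mono) auto
    finally have "h (s + s') \<le> 1 - (1 - h s) * (1 - h s')" by (simp add: h_def)
    also have "\<dots> = h s + h s' - h s * h s'" by (simp add: algebra_simps)
    also have "\<dots> \<le> h s + h s'" by (simp add: h_def transition_def)
    finally show ?thesis .
  qed
  have mult: "h (real (Suc n) * s) \<le> real (Suc n) * h s" if "0 \<le> s" for n s
  proof (induction n)
    case (Suc n)
    have "h (real (Suc (Suc n)) * s) = h (real (Suc n) * s + s)" by (simp add: algebra_simps)
    also have "\<dots> \<le> h (real (Suc n) * s) + h s" using that by (intro sub) auto
    finally show ?case using Suc by (simp add: algebra_simps)
  qed simp
  have "gen q (\<mu> x) (indicator {x}) x = (\<integral>y. - indicator (- {x}) y \<partial>q x (\<mu> x))"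
    unfolding gen_def by (intro Bochner_Integration.integral_cong) (auto simp: indicator_def)
  also have "\<dots> = - measure (q x (\<mu> x)) (- {x})" using sets by simp
  finally have gen: "- gen q (\<mu> x) (indicator {x}) x \<le> \<Lambda>"
    using \<Lambda> Q.finite_measure_mono[of "- {x}" UNIV] sets by simp
  have "(\<lambda>n. - (t * ((transition X (t / real (Suc n)) x {x} - indicator {x} x) / (t / real (Suc n)))))
      \<longlonglongrightarrow> - (t * gen q (\<mu> x) (indicator {x}) x)"
    by (intro tendsto_intros transition_difference_quotient X t)
  moreover have "h t \<le> - (t * ((transition X (t / real (Suc n)) x {x} - indicator {x} x) / (t / real (Suc n))))" for n
  proof -
    define N where "N = real (Suc n)"
    have N: "0 < N" by (simp add: N_def)
    have "- (t * ((p - 1) / (t / N))) = N * (1 - p)" for p using t N by (simp add: field_simps)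
    then show ?thesis
      using mult[of "t / N" n] t N unfolding N_def[symmetric] by (simp add: h_def)
  qed
  ultimately have "h t \<le> - (t * gen q (\<mu> x) (indicator {x}) x)"
    by (intro LIMSEQ_le_const) auto
  also have "\<dots> = t * - gen q (\<mu> x) (indicator {x}) x" by simp
  also have "\<dots> \<le> t * \<Lambda>" using gen t by (intro mult_left_mono) auto
  finally show ?thesis by (simp add: h_def mult.commute)
qed

text \<open>
  The stationary balance equation at \<open>y\<close>: differentiate the invariance of \<open>\<pi>\<close> at time \<open>0\<close>. The
  difference quotients have mean zero, and the uniform exit bound dominates them.
\<close>

lemma mean_gen_indicator_singleton:
  fixes q :: "'s::countable \<Rightarrow> 'u \<Rightarrow> 's measure"
  assumes X: "jump_process q \<mu> X" and inv: "invariant_prob X \<pi>"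
    and fin: "\<And>x. finite_measure (q x (\<mu> x))" and sets: "\<And>x. sets (q x (\<mu> x)) = UNIV"
    and \<Lambda>: "\<And>x. measure (q x (\<mu> x)) UNIV \<le> \<Lambda>"
  shows "integrable \<pi> (\<lambda>x. gen q (\<mu> x) (indicator {y}) x)"
    and "(\<integral>x. gen q (\<mu> x) (indicator {y}) x \<partial>\<pi>) = 0"
proof -
  interpret \<pi>: prob_space \<pi> using inv by (simp add: invariant_prob_def)
  have s\<pi>: "sets \<pi> = UNIV" using inv by (simp add: invariant_prob_def)
  have meas: "f \<in> borel_measurable \<pi>" for f :: "'s \<Rightarrow> real"
    by (subst measurable_cong_sets[of _ "count_space UNIV", OF _ refl]) (simp_all add: s\<pi>)
  define D where "D n x = (transition X (1 / real (Suc n)) x {y} - indicator {y} x) / (1 / real (Suc n))" for n x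
  have D_lim: "(\<lambda>n. D n x) \<longlonglongrightarrow> gen q (\<mu> x) (indicator {y}) x" for x
    unfolding D_def by (rule transition_difference_quotient[OF X]) simp
  have tr: "\<bar>transition X t x {y} - indicator {y} x\<bar> \<le> \<Lambda> * t" if t: "0 < t" for t x
  proof -
    interpret prob_space "X x" using X by (simp add: jump_process_def)
    have [measurable]: "(\<lambda>\<omega>. \<omega> t) \<in> measurable (X x) (count_space UNIV)"
      using X t by (simp add: jump_process_def)
    have exit: "1 - transition X t x {x} \<le> \<Lambda> * t" by (rule exit_probability_le[OF X t fin sets \<Lambda>])
    show ?thesis
    proof (cases "x = y")
      case True
      then show ?thesis using exit prob_le_1[of "{\<omega> \<in> space (X x). \<omega> t = x}"]
        by (simp add: transition_def del: prob_le_1)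
    next
      case False
      have "transition X t x {y} + transition X t x {x} = prob {\<omega> \<in> space (X x). \<omega> t \<in> {x, y}}"
        unfolding transition_def using False
        by (subst finite_measure_Union[symmetric]) (auto intro!: arg_cong[where f = prob])
      also have "\<dots> \<le> 1" by simp
      finally show ?thesis using exit False by (simp add: transition_def)
    qed
  qed
  have "\<bar>D n x\<bar> \<le> \<Lambda>" for n x
  proof -
    define s where "s = 1 / real (Suc n)"
    have "0 < s" by (simp add: s_def)
    then show ?thesis
      using tr[of s x] unfolding D_def s_def[symmetric] by (simp add: abs_divide pos_divide_le_eq)
  qed
  then have bound: "AE x in \<pi>. norm (D n x) \<le> \<Lambda>" for n by simp
  show "integrable \<pi> (\<lambda>x. gen q (\<mu> x) (indicator {y}) x)"
    by (rule integrable_dominated_convergence[where s = D and w = "\<lambda>_. \<Lambda>"])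
       (use meas D_lim bound in auto)
  have lim: "(\<lambda>n. \<integral>x. D n x \<partial>\<pi>) \<longlonglongrightarrow> (\<integral>x. gen q (\<mu> x) (indicator {y}) x \<partial>\<pi>)"
    by (rule integral_dominated_convergence[where w = "\<lambda>_. \<Lambda>"]) (use meas D_lim bound in auto)
  have "(\<integral>x. D n x \<partial>\<pi>) = 0" for n
  proof -
    have int: "integrable \<pi> (\<lambda>x. transition X (1 / real (Suc n)) x {y})"
    proof (rule \<pi>.integrable_const_bound[of _ 1])
      have "transition X (1 / real (Suc n)) x {y} \<le> 1" for x
      proof -
        interpret prob_space "X x" using X by (simp add: jump_process_def)
        show ?thesis by (simp add: transition_def)
      qed
      then show "AE x in \<pi>. norm (transition X (1 / real (Suc n)) x {y}) \<le> 1"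
        by (simp add: transition_def)
    qed (rule meas)
    have ind: "integrable \<pi> (indicator {y} :: 's \<Rightarrow> real)"
      using s\<pi> by (simp add: \<pi>.emeasure_eq_measure)
    have "(\<integral>x. transition X (1 / real (Suc n)) x {y} \<partial>\<pi>) = measure \<pi> {y}"
      using inv by (simp add: invariant_prob_def)
    then show ?thesis
      unfolding D_def using int ind s\<pi> by (simp add: Bochner_Integration.integral_diff)
  qed
  then show "(\<integral>x. gen q (\<mu> x) (indicator {y}) x \<partial>\<pi>) = 0"
    using lim by (simp add: LIMSEQ_const_iff)
qed

text \<open>
  Since sublevel sets of \<open>V\<close> are finite, \<open>\<phi>\<close> is the limit of the finite linear combinations
  \<open>\<phi> 1\<^bsub>V \<le> n\<^esub>\<close> of indicators of points. Dominated convergence is applied twice, to the kernels and to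
  \<open>\<pi>\<close>; the mass and growth bounds on the kernels make \<open>1 + V\<close>, up to a constant, a majorant in both.
\<close>

lemma mean_gen_zero:
  fixes q :: "'s::countable \<Rightarrow> 'u \<Rightarrow> 's measure" and V \<phi> :: "'s \<Rightarrow> real"
  assumes X: "jump_process q \<mu> X" and inv: "invariant_prob X \<pi>"
    and fin: "\<And>x. finite_measure (q x (\<mu> x))" and sets: "\<And>x. sets (q x (\<mu> x)) = UNIV"
    and \<Lambda>: "\<And>x. measure (q x (\<mu> x)) UNIV \<le> \<Lambda>"
    and V: "\<And>x. 0 \<le> V x" "\<And>a. finite {x. V x \<le> a}" "integrable \<pi> V"
    and qV: "\<And>x. (\<integral>\<^sup>+y. ennreal (1 + V y) \<partial>q x (\<mu> x)) \<le> ennreal (\<kappa> * (1 + V x))"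
    and \<phi>: "\<And>x. \<bar>\<phi> x\<bar> \<le> K * (1 + V x)"
  shows "integrable \<pi> (\<lambda>x. gen q (\<mu> x) \<phi> x)" and "(\<integral>x. gen q (\<mu> x) \<phi> x \<partial>\<pi>) = 0"
proof -
  interpret \<pi>: prob_space \<pi> using inv by (simp add: invariant_prob_def)
  have s\<pi>: "sets \<pi> = UNIV" using inv by (simp add: invariant_prob_def)
  have K: "0 \<le> K" using \<phi>[of undefined] V(1)[of undefined] by (smt (verit) mult_neg_pos)
  have V1: "0 < 1 + V x" for x using V(1)[of x] by simp
  have meas\<pi>: "f \<in> borel_measurable \<pi>" for f :: "'s \<Rightarrow> real"
    by (subst measurable_cong_sets[of _ "count_space UNIV", OF _ refl]) (simp_all add: s\<pi>)
  have measq: "f \<in> borel_measurable (q x (\<mu> x))" for f :: "'s \<Rightarrow> real" and x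
    by (subst measurable_cong_sets[of _ "count_space UNIV", OF _ refl]) (simp_all add: sets)
  have intV: "integrable (q x (\<mu> x)) (\<lambda>y. 1 + V y)"
    and leV: "(\<integral>y. 1 + V y \<partial>q x (\<mu> x)) \<le> \<bar>\<kappa>\<bar> * (1 + V x)" for x
  proof -
    have nn: "AE y in q x (\<mu> x). 0 \<le> 1 + V y" using V1 by (simp add: less_imp_le)
    show i: "integrable (q x (\<mu> x)) (\<lambda>y. 1 + V y)"
      using le_less_trans[OF qV[of x] ennreal_less_top] by (intro integrableI_nonneg measq nn) auto
    have "ennreal (\<integral>y. 1 + V y \<partial>q x (\<mu> x)) \<le> ennreal (\<kappa> * (1 + V x))"
      using qV[of x] nn_integral_eq_integral[OF i nn] by simp
    also have "\<dots> \<le> ennreal (\<bar>\<kappa>\<bar> * (1 + V x))"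
      using V1[of x] by (intro ennreal_leI mult_right_mono) auto
    finally show "(\<integral>y. 1 + V y \<partial>q x (\<mu> x)) \<le> \<bar>\<kappa>\<bar> * (1 + V x)"
      using V1[of x] by (subst (asm) ennreal_le_iff) auto
  qed
  have intq: "integrable (q x (\<mu> x)) f" if "\<And>y. \<bar>f y\<bar> \<le> K * (1 + V y)" for f x
  proof (rule Bochner_Integration.integrable_bound[OF integrable_mult_right[where c = K, OF intV] measq])
    show "AE y in q x (\<mu> x). norm (f y) \<le> norm (K * (1 + V y))"
      using that K V1 by (auto simp: abs_mult less_imp_le intro!: order.trans[OF that])
  qed
  have gen_eq: "gen q (\<mu> x) f x = (\<integral>y. f y \<partial>q x (\<mu> x)) - f x * measure (q x (\<mu> x)) UNIV"
    if "integrable (q x (\<mu> x)) f" for f x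
  proof -
    interpret finite_measure "q x (\<mu> x)" by (rule fin)
    have "space (q x (\<mu> x)) = UNIV" using sets_eq_imp_space_eq[of "q x (\<mu> x)" "count_space UNIV"] sets by simp
    then show ?thesis unfolding gen_def using that by (simp add: mult.commute)
  qed
  define \<phi>n where "\<phi>n n x = (if V x \<le> real n then \<phi> x else 0)" for n x
  have \<phi>n_le: "\<bar>\<phi>n n x\<bar> \<le> K * (1 + V x)" for n x
    using \<phi>[of x] K V1[of x] by (auto simp: \<phi>n_def)
  have \<phi>n_lim: "(\<lambda>n. \<phi>n n x) \<longlonglongrightarrow> \<phi> x" for x
  proof (rule tendsto_eventually)
    show "\<forall>\<^sub>F n in sequentially. \<phi>n n x = \<phi> x"
      using eventually_ge_at_top[of "nat \<lceil>V x\<rceil>"] by eventually_elim (auto simp: \<phi>n_def)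
  qed
  have \<phi>n_mean: "(\<integral>x. gen q (\<mu> x) (\<phi>n n) x \<partial>\<pi>) = 0" for n
  proof -
    let ?S = "{y. V y \<le> real n}"
    have \<phi>n_sum: "\<phi>n n = (\<lambda>x. \<Sum>y\<in>?S. \<phi> y * indicator {y} x)"
      using V(2)[of "real n"] by (auto simp: \<phi>n_def indicator_def if_distrib fun_eq_iff sum.delta cong: if_cong)
    have "gen q (\<mu> x) (\<phi>n n) x = (\<Sum>y\<in>?S. \<phi> y * gen q (\<mu> x) (indicator {y}) x)" for x
    proof -
      interpret finite_measure "q x (\<mu> x)" by (rule fin)
      have i: "integrable (q x (\<mu> x)) (\<lambda>z. indicator {y} z - indicator {y} x :: real)" for y
        by (rule integrable_const_bound[of _ 1, OF _ measq]) (auto simp: indicator_def)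
      have "gen q (\<mu> x) (\<phi>n n) x = (\<integral>z. (\<Sum>y\<in>?S. \<phi> y * (indicator {y} z - indicator {y} x)) \<partial>q x (\<mu> x))"
        unfolding gen_def \<phi>n_sum by (simp add: right_diff_distrib sum_subtractf)
      also have "\<dots> = (\<Sum>y\<in>?S. \<phi> y * (\<integral>z. (indicator {y} z - indicator {y} x) \<partial>q x (\<mu> x)))"
        using i by (subst Bochner_Integration.integral_sum) auto
      finally show ?thesis by (simp add: gen_def)
    qed
    then show ?thesis
      using mean_gen_indicator_singleton[OF X inv fin sets \<Lambda>]
      by (subst Bochner_Integration.integral_cong[OF refl])
         (auto simp: Bochner_Integration.integral_sum)
  qed
  have gen_lim: "(\<lambda>n. gen q (\<mu> x) (\<phi>n n) x) \<longlonglongrightarrow> gen q (\<mu> x) \<phi> x" for x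
  proof -
    have "(\<lambda>n. \<integral>y. \<phi>n n y \<partial>q x (\<mu> x)) \<longlonglongrightarrow> (\<integral>y. \<phi> y \<partial>q x (\<mu> x))"
      by (rule integral_dominated_convergence[where w = "\<lambda>y. K * (1 + V y)"])
         (use measq intV \<phi>n_lim \<phi>n_le in \<open>auto intro!: integrable_mult_right\<close>)
    then have "(\<lambda>n. (\<integral>y. \<phi>n n y \<partial>q x (\<mu> x)) - \<phi>n n x * measure (q x (\<mu> x)) UNIV)
        \<longlonglongrightarrow> (\<integral>y. \<phi> y \<partial>q x (\<mu> x)) - \<phi> x * measure (q x (\<mu> x)) UNIV"
      by (intro tendsto_intros \<phi>n_lim)
    then show ?thesis
      using gen_eq[OF intq[OF \<phi>n_le]] gen_eq[OF intq[OF \<phi>]] by simp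
  qed
  have gen_le: "\<bar>gen q (\<mu> x) (\<phi>n n) x\<bar> \<le> K * (\<bar>\<kappa>\<bar> + \<Lambda>) * (1 + V x)" for n x
  proof -
    have "\<bar>\<integral>y. \<phi>n n y \<partial>q x (\<mu> x)\<bar> \<le> (\<integral>y. \<bar>\<phi>n n y\<bar> \<partial>q x (\<mu> x))" by (rule integral_abs_bound)
    also have "\<dots> \<le> (\<integral>y. K * (1 + V y) \<partial>q x (\<mu> x))"
      using intq[OF \<phi>n_le] intV \<phi>n_le by (intro integral_mono integrable_abs integrable_mult_right) auto
    also have "\<dots> \<le> K * (\<bar>\<kappa>\<bar> * (1 + V x))"
      using leV[of x] K by (simp del: Bochner_Integration.integral_add add: mult_left_mono)
    finally have 1: "\<bar>\<integral>y. \<phi>n n y \<partial>q x (\<mu> x)\<bar> \<le> K * (\<bar>\<kappa>\<bar> * (1 + V x))" .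
    have "\<bar>\<phi>n n x * measure (q x (\<mu> x)) UNIV\<bar> \<le> K * (1 + V x) * \<Lambda>"
      unfolding abs_mult using \<phi>n_le[of n x] \<Lambda>[of x] by (intro mult_mono) auto
    then show ?thesis using 1 unfolding gen_eq[OF intq[OF \<phi>n_le]] by (simp add: algebra_simps)
  qed
  have intw: "integrable \<pi> (\<lambda>x. K * (\<bar>\<kappa>\<bar> + \<Lambda>) * (1 + V x))" using V(3) by simp
  have gen_lim': "AE x in \<pi>. (\<lambda>n. gen q (\<mu> x) (\<phi>n n) x) \<longlonglongrightarrow> gen q (\<mu> x) \<phi> x"
    using gen_lim by simp
  have gen_le': "AE x in \<pi>. norm (gen q (\<mu> x) (\<phi>n n) x) \<le> K * (\<bar>\<kappa>\<bar> + \<Lambda>) * (1 + V x)" for n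
    using gen_le by simp
  show "integrable \<pi> (\<lambda>x. gen q (\<mu> x) \<phi> x)"
    by (rule integrable_dominated_convergence[OF meas\<pi> meas\<pi> intw gen_lim' gen_le'])
  have "(\<lambda>n. \<integral>x. gen q (\<mu> x) (\<phi>n n) x \<partial>\<pi>) \<longlonglongrightarrow> (\<integral>x. gen q (\<mu> x) \<phi> x \<partial>\<pi>)"
    by (rule integral_dominated_convergence[OF meas\<pi> meas\<pi> intw gen_lim' gen_le'])
  then show "(\<integral>x. gen q (\<mu> x) \<phi> x \<partial>\<pi>) = 0" using \<phi>n_mean by (simp add: LIMSEQ_const_iff)
qed

section \<open>Functions of bounded weighted norm\<close>

text \<open>
  The maximum with \<open>0\<close> mirrors the truncation of negative reals by \<open>ennreal\<close>.
\<close>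

lemma Vnorm_le_iff:
  assumes V: "\<And>x. 0 \<le> V x"
  shows "Vnorm V \<phi> \<le> ennreal K \<longleftrightarrow> (\<forall>x. \<bar>\<phi> x\<bar> \<le> max 0 K * (1 + V x))"
proof -
  have "ennreal (\<bar>\<phi> x\<bar> / (1 + V x)) \<le> ennreal K \<longleftrightarrow> \<bar>\<phi> x\<bar> \<le> max 0 K * (1 + V x)" for x
  proof -
    have v: "0 < 1 + V x" using V[of x] by simp
    have "ennreal (\<bar>\<phi> x\<bar> / (1 + V x)) \<le> ennreal K \<longleftrightarrow> ennreal (\<bar>\<phi> x\<bar> / (1 + V x)) \<le> ennreal (max 0 K)"
      by (simp add: ennreal_max_0)
    also have "\<dots> \<longleftrightarrow> \<bar>\<phi> x\<bar> / (1 + V x) \<le> max 0 K" by (intro ennreal_le_iff) simp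
    finally show ?thesis using v by (simp add: pos_divide_le_eq)
  qed
  then show ?thesis by (simp add: Vnorm_def SUP_le_iff)
qed

text \<open>
  The mean of \<open>f\<^sub>t\<close> is differentiable with derivative the mean of \<open>f'\<^sub>t\<close>, because the bound on \<open>f'\<close> also
  dominates the difference quotients; then the mean value theorem applies.
\<close>

lemma mean_increment_le:
  fixes f f' :: "real \<Rightarrow> 's::countable \<Rightarrow> real"
  assumes \<pi>: "prob_space \<pi>" "sets \<pi> = UNIV" and V: "\<And>x. 0 \<le> V x" "integrable \<pi> V" and T: "0 < T"
    and deriv: "\<And>t x. t \<in> {0..T} \<Longrightarrow> ((\<lambda>s. f s x) has_real_derivative f' t x) (at t within {0..T})"
    and f: "\<And>t x. t \<in> {0..T} \<Longrightarrow> \<bar>f t x\<bar> \<le> K * (1 + V x)"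
    and f': "\<And>t x. t \<in> {0..T} \<Longrightarrow> \<bar>f' t x\<bar> \<le> K * (1 + V x)"
    and le: "\<And>t. t \<in> {0..T} \<Longrightarrow> (\<integral>x. f' t x \<partial>\<pi>) \<le> B"
  shows "(\<integral>x. (f T x - f 0 x) \<partial>\<pi>) \<le> B * T"
proof -
  interpret prob_space \<pi> by fact
  have meas: "g \<in> borel_measurable \<pi>" for g :: "'s \<Rightarrow> real"
    by (subst measurable_cong_sets[of _ "count_space UNIV", OF _ refl]) (simp_all add: \<pi>)
  have intw: "integrable \<pi> (\<lambda>x. K * (1 + V x))" using V(2) by simp
  have intf: "integrable \<pi> (f t)" if "t \<in> {0..T}" for t
  proof (rule Bochner_Integration.integrable_bound[OF intw meas], rule AE_I2)
    show "norm (f t x) \<le> norm (K * (1 + V x))" for x using f[OF that, of x] by simp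
  qed
  define F where "F t = (\<integral>x. f t x \<partial>\<pi>)" for t
  have F': "(F has_real_derivative (\<integral>x. f' t x \<partial>\<pi>)) (at t within {0..T})" if t: "t \<in> {0..T}" for t
    unfolding has_field_derivative_iff tendsto_at_iff_sequentially
  proof (intro allI impI)
    fix s :: "nat \<Rightarrow> real" assume s: "\<forall>i. s i \<in> {0..T} - {t}" and lim: "s \<longlonglongrightarrow> t"
    have quot: "(\<lambda>i. (f (s i) x - f t x) / (s i - t)) \<longlonglongrightarrow> f' t x" for x
      using deriv[OF t, of x] s lim unfolding has_field_derivative_iff tendsto_at_iff_sequentially
      by (auto simp: o_def)
    have bound: "\<bar>(f (s i) x - f t x) / (s i - t)\<bar> \<le> K * (1 + V x)" for i x
    proof -
      have "norm (f (s i) x - f t x) \<le> K * (1 + V x) * norm (s i - t)"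
        by (rule field_differentiable_bound[of "{0..T}" "\<lambda>s. f s x"])
           (use deriv f' s t in auto)
      moreover have "s i \<noteq> t" using s by auto
      ultimately show ?thesis by (simp add: abs_divide pos_divide_le_eq)
    qed
    have "(\<lambda>i. \<integral>x. (f (s i) x - f t x) / (s i - t) \<partial>\<pi>) \<longlonglongrightarrow> (\<integral>x. f' t x \<partial>\<pi>)"
      by (rule integral_dominated_convergence[OF meas meas intw]) (use quot bound in auto)
    moreover have "(\<integral>x. (f (s i) x - f t x) / (s i - t) \<partial>\<pi>) = (F (s i) - F t) / (s i - t)" for i
    proof -
      have "s i \<in> {0..T}" using s by blast
      then show ?thesis using intf t by (simp add: F_def Bochner_Integration.integral_diff)
    qed
    ultimately show "((\<lambda>y. (F y - F t) / (y - t)) \<circ> s) \<longlonglongrightarrow> (\<integral>x. f' t x \<partial>\<pi>)"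
      by (simp only: o_def)
  qed
  have "\<exists>t\<in>{0..T}. F T - F 0 = (\<integral>x. f' t x \<partial>\<pi>) * (T - 0)"
    using T F' by (intro mvt_very_simple) (auto simp: has_field_derivative_def)
  then obtain t where t: "t \<in> {0..T}" "F T - F 0 = (\<integral>x. f' t x \<partial>\<pi>) * T" by auto
  have "(\<integral>x. (f T x - f 0 x) \<partial>\<pi>) = F T - F 0"
    unfolding F_def using T by (intro Bochner_Integration.integral_diff intf) auto
  also have "\<dots> \<le> B * T" using t le T by (simp add: mult_right_mono)
  finally show ?thesis .
qed

section \<open>The soft optimum exceeds the ergodic value by at most a logarithmic error\<close>

theorem theorem6p1:
  fixes U :: "(real ^ 'k) set"
    and q :: "'s::countable \<Rightarrow> real ^ 'k \<Rightarrow> 's measure"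
    and c :: "'s \<Rightarrow> real ^ 'k \<Rightarrow> real"
    and c2 :: "'s \<Rightarrow> real ^ 'k \<Rightarrow> (real ^ 'k) \<Rightarrow>\<^sub>L (real ^ 'k) \<Rightarrow>\<^sub>L real"
    and V W h :: "'s \<Rightarrow> real"
    and C :: "'s set"
    and r :: "real \<Rightarrow> 's \<Rightarrow> (real ^ 'k) measure"
    and \<rho> :: "real \<Rightarrow> 's \<Rightarrow> real ^ 'k \<Rightarrow> real"
    and ustar :: "'s \<Rightarrow> real ^ 'k"
    and X :: "'s \<Rightarrow> (real \<Rightarrow> 's) measure"
    and \<pi> :: "'s measure"
    and f\<epsilon> :: "real \<Rightarrow> real \<Rightarrow> 's \<Rightarrow> real"
    and fstar :: "real \<Rightarrow> 's \<Rightarrow> real"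
    and b \<rho>lo \<rho>hi m M \<kappa> g T d0 :: real
  assumes kernel: "jump_kernel U q"
    and c_nonneg: "\<And>x u. u \<in> U \<Longrightarrow> 0 \<le> c x u"
    \<comment> \<open>standing stability assumption\<close>
    and V_nonneg: "\<And>x. 0 \<le> V x"
    and V_sublevel: "\<And>a. finite {x. V x \<le> a}"
    and W_ge_1: "\<And>x. 1 \<le> W x"
    and C_compact: "finite C"
    and stability: "\<And>\<mu>. (\<forall>x. \<mu> x \<in> U) \<Longrightarrow>
          (\<exists>Y. jump_process q \<mu> Y \<and> irreducible_process Y \<and> harris_recurrent Y) \<and>
          (\<forall>x. gen q (\<mu> x) V x \<le> - W x + b * indicator C x)"
    and c_le_W: "\<And>x u. u \<in> U \<Longrightarrow> c x u \<le> W x"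
    \<comment> \<open>(1)\<close>
    and U: "compact U" "convex U" "interior U \<noteq> {}"
    and gen_affine: "\<And>\<phi> x. Vnorm V \<phi> < \<infinity> \<Longrightarrow> affine_fun_on U (\<lambda>u. gen q u \<phi> x)"
    \<comment> \<open>(2)\<close>
    and T: "0 < T"
    and r_kernel: "(\<lambda>(t, x). r t x) \<in> measurable
          (restrict_space borel {0..T} \<Otimes>\<^sub>M count_space UNIV) (prob_algebra (restrict_space borel U))"
    and r_density: "\<And>t x. t \<in> {0..T} \<Longrightarrow>
          r t x = density (restrict_space lborel U) (\<lambda>u. ennreal (\<rho> t x u))"
    and \<rho>_cont: "\<And>t x. t \<in> {0..T} \<Longrightarrow> continuous_on U (\<rho> t x)"
    and \<rho>lo: "0 < \<rho>lo"
    and \<rho>_bounds: "\<And>t x u. t \<in> {0..T} \<Longrightarrow> u \<in> U \<Longrightarrow> \<rho>lo \<le> \<rho> t x u \<and> \<rho> t x u \<le> \<rho>hi"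
    and \<rho>_equicont: "\<And>e. 0 < e \<Longrightarrow> \<exists>d>0. \<forall>t\<in>{0..T}. \<forall>x. \<forall>u\<in>U. \<forall>v\<in>U.
          dist u v < d \<longrightarrow> \<bar>\<rho> t x u - \<rho> t x v\<bar> < e"
    \<comment> \<open>(3)\<close>
    and c_C3: "\<And>x. C3_on U (c x) (c2 x)"
    and mM: "0 < m" "m \<le> M"
    and c_hessian: "\<And>x u v. u \<in> U \<Longrightarrow> m * (v \<bullet> v) \<le> c2 x u v v \<and> c2 x u v v \<le> M * (v \<bullet> v)"
    \<comment> \<open>(4)\<close>
    and rates_bounded: "(SUP x. SUP u\<in>U. emeasure (q x u) UNIV) < \<infinity>"
    and rates_V: "\<And>x. (SUP u\<in>U. \<integral>\<^sup>+y. ennreal (1 + V y) \<partial>q x u) \<le> ennreal (\<kappa> * (1 + V x))"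
    \<comment> \<open>(5)\<close>
    and h_norm: "Vnorm V h < \<infinity>"
    and ustar_max: "\<And>x. is_arg_max (\<lambda>u. gen q u h x - c x u) (\<lambda>u. u \<in> U) (ustar x)"
    and hjb: "\<And>x. g + gen q (ustar x) h x = c x (ustar x)"
    \<comment> \<open>(6)\<close>
    and inf_c_sublevel: "\<And>a. finite {x. (INF u\<in>U. c x u) \<le> a}"
    and c_loc_bounded: "\<And>K. compactin (prod_topology (discrete_topology UNIV) (top_of_set U)) K
          \<Longrightarrow> bounded ((\<lambda>(x, u). c x u) ` K)"
    and h_bdd: "bdd_below (range (\<lambda>x. - h x))"
    and h_sublevel: "\<And>a. finite {x. - h x \<le> a}"
    and X: "jump_process q ustar X" "irreducible_process X"
    and \<pi>_invariant: "invariant_prob X \<pi>"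
    and \<pi>_unique: "\<And>\<nu>. invariant_prob X \<nu> \<Longrightarrow> \<nu> = \<pi>"
    and V_integrable: "(\<integral>\<^sup>+x. ennreal (V x) \<partial>\<pi>) < \<infinity>"
    \<comment> \<open>the optimizers\<close>
    and fstar: "fstar = (\<lambda>t x. h x + (t - T) * g)"
    and f\<epsilon>_opt: "\<And>\<epsilon>. 0 < \<epsilon> \<Longrightarrow>
          is_arg_max (\<lambda>f. \<integral>x. (f T x - f 0 x) \<partial>\<pi>) (\<lambda>f. f \<in> F_soft q c r V T \<epsilon>) (f\<epsilon> \<epsilon>)"
    and d0: "0 < d0"
    and interior_max: "\<And>\<epsilon> f t x u. 0 < \<epsilon> \<Longrightarrow> f \<in> {fstar, f\<epsilon> \<epsilon>} \<Longrightarrow> t \<in> {0..T} \<Longrightarrow>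
          is_arg_max (\<lambda>u. gen q u (f t) x - c x u) (\<lambda>u. u \<in> U) u \<Longrightarrow> d0 \<le> infdist u (frontier U)"
  shows "(\<forall>\<epsilon>>0. 0 \<le> (\<integral>x. (f\<epsilon> \<epsilon> T x - f\<epsilon> \<epsilon> 0 x) \<partial>\<pi>) - g * T) \<and>
         (\<lambda>\<epsilon>. (\<integral>x. (f\<epsilon> \<epsilon> T x - f\<epsilon> \<epsilon> 0 x) \<partial>\<pi>) - g * T) \<in> O[at_right 0](\<lambda>\<epsilon>. T * \<epsilon> * ln (1 / \<epsilon>))"
proof -
  have ustar_U: "ustar x \<in> U" for x using ustar_max[of x] by (simp add: is_arg_max_def)
  have V1: "0 < 1 + V x" for x using V_nonneg[of x] by simp
  have r_prob: "prob_space (r t x)" and r_sets: "sets (r t x) = sets (restrict_space borel U)"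
    if "t \<in> {0..T}" for t x
  proof -
    have "(t, x) \<in> space (restrict_space borel {0..T} \<Otimes>\<^sub>M count_space UNIV)"
      using that by (simp add: space_pair_measure space_restrict_space)
    from measurable_space[OF r_kernel this]
    show "prob_space (r t x)" "sets (r t x) = sets (restrict_space borel U)"
      by (simp_all add: space_prob_algebra)
  qed
  have gen_cont: "continuous_on U (\<lambda>u. gen q u \<phi> x)" if "Vnorm V \<phi> < \<infinity>" for \<phi> x
    by (rule affine_fun_on_continuous_on[OF U(2,3) gen_affine[OF that]])
  have c_cont: "continuous_on U (c x)" for x
    by (rule C3_on_imp_continuous_on[OF c_C3])

  obtain Kh where Kh: "\<And>x. \<bar>h x\<bar> \<le> Kh * (1 + V x)" "0 \<le> Kh"
  proof -
    obtain K where "Vnorm V h \<le> ennreal K"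
      using h_norm by (cases "Vnorm V h") auto
    then show ?thesis using that[of "max 0 K"] by (simp add: Vnorm_le_iff[OF V_nonneg])
  qed
  interpret \<pi>: prob_space \<pi> using \<pi>_invariant by (simp add: invariant_prob_def)
  have s\<pi>: "sets \<pi> = UNIV" using \<pi>_invariant by (simp add: invariant_prob_def)
  have meas: "\<phi> \<in> borel_measurable \<pi>" for \<phi> :: "'s \<Rightarrow> real"
    by (subst measurable_cong_sets[of _ "count_space UNIV", OF _ refl]) (simp_all add: s\<pi>)
  have intV: "integrable \<pi> V"
    using V_integrable V_nonneg by (intro integrableI_nonneg meas) auto

  \<comment> \<open>The maximum of \<open>G\<^sup>u h - c\<close> is \<open>- g\<close>, and adding a constant to \<open>h\<close> leaves the generator unchanged.\<close>
  have fstar_F: "fstar \<in> F_soft q c r V T \<epsilon>" if \<epsilon>: "0 < \<epsilon>" for \<epsilon>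
    unfolding F_soft_def mem_Collect_eq
  proof (intro exI[of _ "\<lambda>t x. g"] conjI allI ballI)
    show "((\<lambda>s. fstar s x) has_real_derivative g) (at t within {0..T})" for t x
      unfolding fstar by (auto intro!: derivative_eq_intros)
    have "Vnorm V (fstar t) \<le> ennreal (Kh + T * \<bar>g\<bar>)" if t: "t \<in> {0..T}" for t
    proof -
      have "\<bar>fstar t x\<bar> \<le> max 0 (Kh + T * \<bar>g\<bar>) * (1 + V x)" for x
      proof -
        have "\<bar>(t - T) * g\<bar> \<le> T * \<bar>g\<bar>" using t by (auto simp: abs_mult intro!: mult_right_mono)
        also have "\<dots> \<le> T * \<bar>g\<bar> * (1 + V x)" using mult_left_mono[of 1 "1 + V x" "T * \<bar>g\<bar>"] T V_nonneg[of x] by simp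
        finally have "\<bar>fstar t x\<bar> \<le> (Kh + T * \<bar>g\<bar>) * (1 + V x)"
          using Kh(1)[of x] unfolding fstar by (simp add: distrib_right)
        then show ?thesis using Kh(2) T by simp
      qed
      then show ?thesis by (simp add: Vnorm_le_iff[OF V_nonneg])
    qed
    then have "(SUP t\<in>{0..T}. Vnorm V (fstar t)) \<le> ennreal (Kh + T * \<bar>g\<bar>)" by (rule SUP_least)
    moreover have "(SUP t\<in>{0..T}. Vnorm V (\<lambda>x. g)) \<le> ennreal \<bar>g\<bar>"
    proof (rule SUP_least)
      have "\<bar>g\<bar> \<le> \<bar>g\<bar> * (1 + V x)" for x using V_nonneg[of x] by (simp add: mult_le_cancel_left1)
      then show "Vnorm V (\<lambda>x. g) \<le> ennreal \<bar>g\<bar>" by (simp add: Vnorm_le_iff[OF V_nonneg])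
    qed
    ultimately have "(SUP t\<in>{0..T}. Vnorm V (fstar t)) + (SUP t\<in>{0..T}. Vnorm V (\<lambda>x. g))
        \<le> ennreal (Kh + T * \<bar>g\<bar>) + ennreal \<bar>g\<bar>"
      by (rule add_mono)
    also have "\<dots> < \<infinity>" by simp
    finally show "(SUP t\<in>{0..T}. Vnorm V (fstar t)) + (SUP t\<in>{0..T}. Vnorm V (\<lambda>x. g)) < \<infinity>" .
    show "g + soft_hamiltonian q c r \<epsilon> fstar t x \<le> 0" if t: "t \<in> {0..T}" for t x
    proof -
      have gen: "gen q u (fstar t) x = gen q u h x" for u by (simp add: gen_def fstar)
      have "soft_hamiltonian q c r \<epsilon> fstar t x \<le> - g"
        unfolding soft_hamiltonian_def gen
      proof (rule soft_max_le[OF r_prob[OF t] r_sets[OF t] U(1) _ \<epsilon>])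
        show "continuous_on U (\<lambda>u. gen q u h x - c x u)"
          by (intro continuous_on_diff gen_cont c_cont h_norm)
        show "gen q u h x - c x u \<le> - g" if "u \<in> U" for u
          using ustar_max[of x] that hjb[of x] by (force simp: is_arg_max_def not_less)
      qed
      then show ?thesis by simp
    qed
  qed (rule continuous_on_const)

  \<comment> \<open>\<open>f\<^sup>*\<close> is a competitor with value \<open>g T\<close>.\<close>
  have lower: "0 \<le> (\<integral>x. (f\<epsilon> \<epsilon> T x - f\<epsilon> \<epsilon> 0 x) \<partial>\<pi>) - g * T" if \<epsilon>: "0 < \<epsilon>" for \<epsilon>
  proof -
    have "(\<integral>x. (fstar T x - fstar 0 x) \<partial>\<pi>) \<le> (\<integral>x. (f\<epsilon> \<epsilon> T x - f\<epsilon> \<epsilon> 0 x) \<partial>\<pi>)"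
      using f\<epsilon>_opt[OF \<epsilon>] fstar_F[OF \<epsilon>] by (auto simp: is_arg_max_def not_less)
    moreover have "(\<integral>x. (fstar T x - fstar 0 x) \<partial>\<pi>) = g * T"
      by (simp add: fstar \<pi>.prob_space mult.commute)
    ultimately show ?thesis by simp
  qed

  have q_fin: "finite_measure (q x (ustar x))" and q_sets: "sets (q x (ustar x)) = UNIV" for x
    using kernel ustar_U[of x] unfolding jump_kernel_def by auto
  obtain \<Lambda> where q_le: "\<And>x. measure (q x (ustar x)) UNIV \<le> \<Lambda>"
  proof -
    obtain \<Lambda> where \<Lambda>: "(SUP x. SUP u\<in>U. emeasure (q x u) UNIV) = ennreal \<Lambda>" "0 \<le> \<Lambda>"
      using rates_bounded by (cases "SUP x. SUP u\<in>U. emeasure (q x u) UNIV") auto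
    have "measure (q x (ustar x)) UNIV \<le> \<Lambda>" for x
    proof -
      have "emeasure (q x (ustar x)) UNIV \<le> (SUP u\<in>U. emeasure (q x u) UNIV)"
        by (rule SUP_upper[where f = "\<lambda>u. emeasure (q x u) UNIV", OF ustar_U])
      also have "\<dots> \<le> ennreal \<Lambda>" unfolding \<Lambda>(1)[symmetric] by (rule SUP_upper[OF UNIV_I])
      finally have "emeasure (q x (ustar x)) UNIV \<le> ennreal \<Lambda>" .
      then show ?thesis using \<Lambda>(2) finite_measure.emeasure_eq_measure[OF q_fin[of x]] by simp
    qed
    then show ?thesis by (rule that)
  qed
  have qV: "(\<integral>\<^sup>+y. ennreal (1 + V y) \<partial>q x (ustar x)) \<le> ennreal (\<kappa> * (1 + V x))" for x
    by (rule order.trans[OF SUP_upper[where f = "\<lambda>u. \<integral>\<^sup>+y. ennreal (1 + V y) \<partial>q x u", OF ustar_U] rates_V])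
  note mean_gen = mean_gen_zero[OF X(1) \<pi>_invariant q_fin q_sets q_le V_nonneg V_sublevel intV qV]

  let ?n = "real DIM(real ^ 'k)"
  let ?L = "M - ln (\<rho>lo * unit_ball_vol ?n)"
  define \<delta> where "\<delta> \<epsilon> = \<epsilon> * (?L + ?n / 2 * ln (1 / \<epsilon>))" for \<epsilon>
  have upper: "(\<integral>x. (f\<epsilon> \<epsilon> T x - f\<epsilon> \<epsilon> 0 x) \<partial>\<pi>) - g * T \<le> T * \<delta> \<epsilon>"
    if \<epsilon>: "0 < \<epsilon>" "sqrt \<epsilon> \<le> d0" for \<epsilon>
  proof -
    have "f\<epsilon> \<epsilon> \<in> F_soft q c r V T \<epsilon>" using f\<epsilon>_opt[OF \<epsilon>(1)] by (simp add: is_arg_max_def)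
    then obtain f' where
      deriv: "\<forall>x. \<forall>t\<in>{0..T}. ((\<lambda>s. f\<epsilon> \<epsilon> s x) has_real_derivative f' t x) (at t within {0..T})" and
      norm: "(SUP t\<in>{0..T}. Vnorm V (f\<epsilon> \<epsilon> t)) + (SUP t\<in>{0..T}. Vnorm V (f' t)) < \<infinity>" and
      sub: "\<forall>t\<in>{0..T}. \<forall>x. f' t x + soft_hamiltonian q c r \<epsilon> (f\<epsilon> \<epsilon>) t x \<le> 0"
      unfolding F_soft_def mem_Collect_eq by (elim exE conjE)
    obtain K where K: "(SUP t\<in>{0..T}. Vnorm V (f\<epsilon> \<epsilon> t)) + (SUP t\<in>{0..T}. Vnorm V (f' t)) = ennreal K" "0 \<le> K"
      using norm by (cases "(SUP t\<in>{0..T}. Vnorm V (f\<epsilon> \<epsilon> t)) + (SUP t\<in>{0..T}. Vnorm V (f' t))") auto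
    have Vn: "Vnorm V (f\<epsilon> \<epsilon> t) \<le> ennreal K" "Vnorm V (f' t) \<le> ennreal K" if t: "t \<in> {0..T}" for t
    proof -
      have "Vnorm V (f\<epsilon> \<epsilon> t) \<le> (SUP t\<in>{0..T}. Vnorm V (f\<epsilon> \<epsilon> t))" using t by (rule SUP_upper)
      then show "Vnorm V (f\<epsilon> \<epsilon> t) \<le> ennreal K" unfolding K(1)[symmetric] by (rule add_increasing2[OF zero_le])
      have "Vnorm V (f' t) \<le> (SUP t\<in>{0..T}. Vnorm V (f' t))" using t by (rule SUP_upper)
      then show "Vnorm V (f' t) \<le> ennreal K" unfolding K(1)[symmetric] by (rule add_increasing[OF zero_le])
    qed
    have f_le: "\<bar>f\<epsilon> \<epsilon> t x\<bar> \<le> K * (1 + V x)" and f'_le: "\<bar>f' t x\<bar> \<le> K * (1 + V x)" if "t \<in> {0..T}" for t x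
      using Vn[OF that] K(2) by (simp_all add: Vnorm_le_iff[OF V_nonneg])
    \<comment> \<open>Bounding the maximum in the Hamiltonian of \<open>f\<close> below by its value at the control that is maximal
      for \<open>h\<close> makes the running cost the one in the optimality equation.\<close>
    have ham: "f' t x \<le> g + gen q (ustar x) h x - gen q (ustar x) (f\<epsilon> \<epsilon> t) x + \<delta> \<epsilon>" if t: "t \<in> {0..T}" for t x
    proof -
      have "gen q (ustar x) (f\<epsilon> \<epsilon> t) x - c x (ustar x) - \<delta> \<epsilon> \<le> soft_hamiltonian q c r \<epsilon> (f\<epsilon> \<epsilon>) t x"
        unfolding soft_hamiltonian_def \<delta>_def
      proof (rule soft_max_ge_max[OF r_prob[OF t] r_density[OF t] \<rho>_cont[OF t] \<rho>lo _ U _ c_C3 _ _ _ \<epsilon> ustar_U])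
        show "\<rho>lo \<le> \<rho> t x u" if "u \<in> U" for u using \<rho>_bounds[OF t that] by blast
        show "affine_fun_on U (\<lambda>u. gen q u (f\<epsilon> \<epsilon> t) x)"
          by (rule gen_affine) (use Vn(1)[OF t] in \<open>auto intro: order.strict_trans1\<close>)
        show "c2 x u v v \<le> M * (v \<bullet> v)" if "u \<in> U" for u v using c_hessian[OF that] by blast
        show "0 \<le> M" using mM by simp
        show "d0 \<le> infdist u (frontier U)"
          if "is_arg_max (\<lambda>u. gen q u (f\<epsilon> \<epsilon> t) x - c x u) (\<lambda>u. u \<in> U) u" for u
          by (rule interior_max[of \<epsilon> "f\<epsilon> \<epsilon>" t x u, OF \<epsilon>(1) _ t that]) simp
      qed
      then show ?thesis using sub[rule_format, OF t, of x] hjb[of x] by linarith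
    qed
    have "(\<integral>x. f' t x \<partial>\<pi>) \<le> g + \<delta> \<epsilon>" if t: "t \<in> {0..T}" for t
    proof -
      note h0 = mean_gen[OF Kh(1)] and f0 = mean_gen[OF f_le[OF t]]
      have "integrable \<pi> (\<lambda>x. K * (1 + V x))" using intV by simp
      then have "integrable \<pi> (f' t)"
      proof (rule Bochner_Integration.integrable_bound[OF _ meas], intro AE_I2)
        show "norm (f' t x) \<le> norm (K * (1 + V x))" for x using f'_le[OF t, of x] by simp
      qed
      then have "(\<integral>x. f' t x \<partial>\<pi>) \<le> (\<integral>x. g + gen q (ustar x) h x - gen q (ustar x) (f\<epsilon> \<epsilon> t) x + \<delta> \<epsilon> \<partial>\<pi>)"
        using h0(1) f0(1) ham[OF t] by (intro integral_mono) auto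
      also have "\<dots> = g + \<delta> \<epsilon>" using h0 f0 by (simp add: \<pi>.prob_space)
      finally show ?thesis .
    qed
    then have "(\<integral>x. (f\<epsilon> \<epsilon> T x - f\<epsilon> \<epsilon> 0 x) \<partial>\<pi>) \<le> (g + \<delta> \<epsilon>) * T"
      by (intro mean_increment_le[OF \<pi>.prob_space_axioms s\<pi> V_nonneg intV T deriv[rule_format] f_le f'_le])
    then show ?thesis by (simp add: algebra_simps)
  qed

  define A where "A = \<bar>?L\<bar> + ?n / 2"
  \<comment> \<open>The constant part of \<open>\<delta>\<close> is absorbed once \<open>ln (1 / \<epsilon>) \<ge> 1\<close>, that is \<open>\<epsilon> \<le> exp (- 1)\<close>.\<close>
  have \<delta>_le: "\<delta> \<epsilon> \<le> A * (\<epsilon> * ln (1 / \<epsilon>))" if \<epsilon>: "0 < \<epsilon>" "\<epsilon> < exp (- 1)" for \<epsilon>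
  proof -
    have "ln \<epsilon> < - 1" using \<epsilon> by (metis exp_gt_zero ln_exp ln_less_cancel_iff)
    then have "1 \<le> ln (1 / \<epsilon>)" using \<epsilon> by (simp add: ln_div)
    then have "\<bar>?L\<bar> * 1 \<le> \<bar>?L\<bar> * ln (1 / \<epsilon>)" by (intro mult_left_mono) auto
    then have "?L + ?n / 2 * ln (1 / \<epsilon>) \<le> A * ln (1 / \<epsilon>)" by (simp add: A_def distrib_right)
    then have "\<epsilon> * (?L + ?n / 2 * ln (1 / \<epsilon>)) \<le> \<epsilon> * (A * ln (1 / \<epsilon>))"
      using \<epsilon>(1) by (intro mult_left_mono) auto
    then show ?thesis by (simp add: \<delta>_def mult.left_commute)
  qed
  have "(\<lambda>\<epsilon>. (\<integral>x. (f\<epsilon> \<epsilon> T x - f\<epsilon> \<epsilon> 0 x) \<partial>\<pi>) - g * T) \<in> O[at_right 0](\<lambda>\<epsilon>. T * \<epsilon> * ln (1 / \<epsilon>))"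
  proof (rule bigoI[of _ A])
    have "\<forall>\<^sub>F \<epsilon> in at_right 0. 0 < \<epsilon> \<and> \<epsilon> < min (d0\<^sup>2) (exp (- 1))"
      using d0 unfolding eventually_at_right_field by (intro exI[of _ "min (d0\<^sup>2) (exp (- 1))"]) auto
    then show "\<forall>\<^sub>F \<epsilon> in at_right 0. norm ((\<integral>x. (f\<epsilon> \<epsilon> T x - f\<epsilon> \<epsilon> 0 x) \<partial>\<pi>) - g * T) \<le> A * norm (T * \<epsilon> * ln (1 / \<epsilon>))"
    proof eventually_elim
      case (elim \<epsilon>)
      then have \<epsilon>: "0 < \<epsilon>" "\<epsilon> < d0\<^sup>2" "\<epsilon> < exp (- 1)" by auto
      have "sqrt \<epsilon> \<le> d0" using \<epsilon>(2) d0 by (intro real_le_lsqrt) auto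
      then have "(\<integral>x. (f\<epsilon> \<epsilon> T x - f\<epsilon> \<epsilon> 0 x) \<partial>\<pi>) - g * T \<le> T * \<delta> \<epsilon>" by (rule upper[OF \<epsilon>(1)])
      also have "\<dots> \<le> T * (A * (\<epsilon> * ln (1 / \<epsilon>)))" using \<delta>_le[OF \<epsilon>(1,3)] T by (intro mult_left_mono) auto
      also have "\<dots> = A * (T * \<epsilon> * ln (1 / \<epsilon>))" by simp
      also have "\<dots> \<le> A * norm (T * \<epsilon> * ln (1 / \<epsilon>))" by (intro mult_left_mono) (auto simp: A_def)
      finally show ?case using lower[OF \<epsilon>(1)] by simp
    qed
  qed
  with lower show ?thesis by blast
qed

end
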